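(* Let $k\ge 0$ be an integer and let $\zeta$ be a primitive root of unity of order $2k+1$. Define, for $|q|<1$, \[ w(q):=\sum_{n=0}^{\infty}\frac{q^{2n(n+1)}}{(q;q^2)_{n+1}^2}, \qquad \theta(q):=\frac{\overline{J}_{1,4}^2\,\overline{J}_{2,4}}{\overline{J}_{0,4}\,J_{2}}. \] Then, as $q$ approaches $\zeta$ radially within the unit disk, \[ \lim_{q\rightarrow \zeta} \Big ( q\, w(q)-\theta(q) \Big )=-\sum_{n=0}^{k}(1-\zeta)^2(1-\zeta^3)^2\cdots(1-\zeta^{2n-1})^2\,\zeta^{2n+1}, \] where for $n=0$ the empty product equals $1$.
   Context: Throughout, $q$ is a complex number with $0<|q|<1$. For $x\in\mathbb{C}$ and $n\ge 0$, $(x;q)_n:=\prod_{i=0}^{n-1}(1-xq^i)$ and $(x;q)_\infty:=\prod_{i\ge 0}(1-xq^i)$. The theta function is $j(x;q):=(x;q)_\infty(q/x;q)_\infty(q;q)_\infty$. For integers $a$ and $m>0$: $J_{a,m}:=j(q^a;q^m)$, $J_m:=(q^m;q^m)_\infty$, and $\overline{J}_{a,m}:=j(-q^a;q^m)$. "$q$ approaches $\zeta$ radially" means $q=r\zeta$ with $r\to 1^-$. *)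

theory Defs
  imports "HOL-Analysis.Analysis"
begin

text \<open>
  The base \<open>q\<close> is meant to satisfy \<open>0 < norm q < 1\<close>; then all infinite products and series
  below converge. Note that \<^const>\<open>prodinf\<close> correctly yields \<open>0\<close> for convergent products with
  finitely many vanishing factors.
\<close>

definition qpoch :: "complex \<Rightarrow> complex \<Rightarrow> nat \<Rightarrow> complex" where
  "qpoch x q n = (\<Prod>i<n. 1 - x * q ^ i)"

definition qpoch_inf :: "complex \<Rightarrow> complex \<Rightarrow> complex" where
  "qpoch_inf x q = prodinf (\<lambda>i. 1 - x * q ^ i)"

definition jtheta :: "complex \<Rightarrow> complex \<Rightarrow> complex" where
  "jtheta x q = qpoch_inf x q * qpoch_inf (q / x) q * qpoch_inf q q"

definition J_single :: "nat \<Rightarrow> complex \<Rightarrow> complex" where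
  "J_single m q = qpoch_inf (q ^ m) (q ^ m)"

definition J_bar :: "int \<Rightarrow> nat \<Rightarrow> complex \<Rightarrow> complex" where
  "J_bar a m q = jtheta (- (q powi a)) (q ^ m)"

definition mock_w :: "complex \<Rightarrow> complex" where
  "mock_w q = (\<Sum>n. q ^ (2 * n * (n + 1)) / (qpoch q (q ^ 2) (n + 1)) ^ 2)"

definition theta_w :: "complex \<Rightarrow> complex" where
  "theta_w q = (J_bar 1 4 q) ^ 2 * J_bar 2 4 q / (J_bar 0 4 q * J_single 2 q)"

definition primitive_root_of_unity :: "nat \<Rightarrow> complex \<Rightarrow> bool" where
  "primitive_root_of_unity n z \<longleftrightarrow>
     n > 0 \<and> z ^ n = 1 \<and> (\<forall>m. 0 < m \<and> m < n \<longrightarrow> z ^ m \<noteq> 1)"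

end

theory Submission
  imports Defs "HOL-Computational_Algebra.Polynomial"
begin

text \<open>
  Continuing the summand of \<open>mock_w q\<close> to negative indices adds the series of
  \<open>(q; q\<^sup>2)\<^sub>m\<^sup>2 q\<^sup>2\<^sup>m\<close>, which terminates at roots of unity of odd order and produces the right-hand
  side. The bilateral series is the value at \<open>x = q\<close> of a two-variable series that Euler's expansion
  splits into two theta functions \<open>\<phi>\<close>, \<open>\<psi>\<close> of base \<open>q\<^sup>4\<close> with Appell-type coefficients. Its value at
  \<open>x = 1\<close> is a product, by the Durfee rectangle identity, and involves the same two coefficients.
  Eliminating one of them shows that \<open>q\<close> times the bilateral series equals \<open>theta_w q\<close> up to a
  correction \<open>(q; q\<^sup>2)\<^sub>\<infinity>\<^sup>2 / \<psi>\<close> times a coefficient of polynomial growth in \<open>1 / (1 - \<bar>q\<bar>)\<close>. Expanding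
  the logarithm of the products shows that the correction decays exponentially as \<open>q\<close> approaches a
  root of unity of odd order.
\<close>

section \<open>Infinite q-products\<close>

text \<open>At \<open>x = q\<close> the bilateral series yields one equation in two unknowns,
  \<open>U 1\<close> and \<open>V 1\<close>. The value at \<open>x = 1\<close> involves
  \<open>U 0\<close> and \<open>V 0\<close> instead, but the reflection and the recurrence of
  \<open>S\<close> convert these into \<open>V 1\<close> and \<open>U 1\<close>, so both values are
  linear equations in the same unknowns. Their determinant is
  \<open>\<phi>^2 - q * \<psi>^2\<close>, the square of a theta product; this is what remains in
  front of \<open>U 1\<close> after the elimination and what makes the correction small. In the
  terminating series the obstacle is that no summable majorant is independent of r = |q|: the powers
  of q alone sum to the order 1/(1-r). The products are therefore shown to be O(1-r) uniformly from
  the first full period on; being squared in the summand, they win by one power of 1-r. Odd order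
  enters twice. Some factor 1 - \<zeta>^(2i+1) vanishes, which terminates the series; and 2 and 4
  are invertible modulo the order, so the logarithms of all products involved have their poles at
  the same indices, where the combined residue is negative.\<close>

lemma abs_convergent_prod_qpoch:
  fixes x q :: complex
  assumes "norm q < 1"
  shows "abs_convergent_prod (\<lambda>i. 1 - x * q ^ i)"
  unfolding abs_convergent_prod_conv_summable
  using assms by (auto simp: norm_mult norm_power intro!: summable_mult summable_geometric)

lemma qpoch_LIMSEQ:
  assumes "norm q < 1"
  shows "(\<lambda>n. qpoch x q n) \<longlonglongrightarrow> qpoch_inf x q"
proof -
  have "convergent_prod (\<lambda>i. 1 - x * q ^ i)"
    by (rule abs_convergent_prod_imp_convergent_prod[OF abs_convergent_prod_qpoch[OF assms]])
  from convergent_prod_LIMSEQ[OF this] show ?thesis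
    unfolding qpoch_def qpoch_inf_def by (simp add: LIMSEQ_lessThan_iff_atMost)
qed

lemma qpoch_inf_nonzero:
  assumes "norm q < 1" "\<And>i. x * q ^ i \<noteq> 1"
  shows "qpoch_inf x q \<noteq> 0"
  unfolding qpoch_inf_def
proof (rule prodinf_nonzero)
  show "convergent_prod (\<lambda>i. 1 - x * q ^ i)"
    by (rule abs_convergent_prod_imp_convergent_prod[OF abs_convergent_prod_qpoch[OF assms(1)]])
  show "1 - x * q ^ i \<noteq> 0" for i using assms(2)[of i] by simp
qed

lemma mult_power_neq_1:
  fixes x q :: complex
  assumes "norm q < 1" "norm x < 1"
  shows "x * q ^ i \<noteq> 1"
proof -
  have "norm (x * q ^ i) \<le> norm x * 1"
    unfolding norm_mult norm_power
    by (intro mult_left_mono power_le_one) (use assms in auto)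
  then show ?thesis using assms by auto
qed

lemma qpoch_inf_nonzero_norm:
  assumes "norm q < 1" "norm x < 1"
  shows "qpoch_inf x q \<noteq> 0"
  using qpoch_inf_nonzero mult_power_neq_1 assms by blast

lemma qpoch_nonzero:
  assumes "norm q < 1" "norm x < 1"
  shows "qpoch x q n \<noteq> 0"
  using mult_power_neq_1[OF assms] by (auto simp: qpoch_def)

lemma qpoch_0 [simp]: "qpoch x q 0 = 1"
  by (simp add: qpoch_def)

lemma qpoch_Suc: "qpoch x q (Suc n) = qpoch x q n * (1 - x * q ^ n)"
  by (simp add: qpoch_def)

lemma qpoch_add: "qpoch x q (m + n) = qpoch x q m * qpoch (x * q ^ m) q n"
  by (induction n) (simp_all add: qpoch_Suc power_add mult_ac)

lemma qpoch_inf_split: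
  assumes "norm q < 1"
  shows "qpoch_inf x q = qpoch x q n * qpoch_inf (x * q ^ n) q"
proof (rule LIMSEQ_unique)
  show "(\<lambda>m. qpoch x q (n + m)) \<longlonglongrightarrow> qpoch_inf x q"
    using qpoch_LIMSEQ[OF assms, of x] LIMSEQ_ignore_initial_segment[of _ _ n]
    by (simp add: add.commute)
  show "(\<lambda>m. qpoch x q (n + m)) \<longlonglongrightarrow> qpoch x q n * qpoch_inf (x * q ^ n) q"
    unfolding qpoch_add by (intro tendsto_intros qpoch_LIMSEQ assms)
qed

text \<open>The functional equation is required only along the orbit \<open>y * q ^ n\<close>, so
  the lemma also covers an \<open>F\<close> given by a series that converges only in the unit disk.
  The orbit tends to 0, where continuity and \<open>F 0 = 1\<close> fix the value.\<close>

lemma qpoch_inf_unique: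
  fixes F :: "complex \<Rightarrow> complex"
  assumes q: "norm q < 1"
    and step: "\<And>n. F (y * q ^ n) = (1 - y * q ^ n) * F (y * q ^ Suc n)"
    and cont: "isCont F 0" and F0: "F 0 = 1"
  shows "F y = qpoch_inf y q"
proof -
  have *: "F y = qpoch y q n * F (y * q ^ n)" for n
  proof (induction n)
    case (Suc n)
    then show ?case using step[of n] by (simp add: qpoch_Suc)
  qed simp
  have "(\<lambda>n. y * q ^ n) \<longlonglongrightarrow> y * 0"
    by (intro tendsto_intros LIMSEQ_power_zero q)
  then have "(\<lambda>n. F (y * q ^ n)) \<longlonglongrightarrow> F 0"
    using isCont_tendsto_compose[OF cont] by simp
  then have "(\<lambda>n. qpoch y q n * F (y * q ^ n)) \<longlonglongrightarrow> qpoch_inf y q * 1"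
    unfolding F0 by (intro tendsto_mult qpoch_LIMSEQ q)
  moreover have "(\<lambda>n. qpoch y q n * F (y * q ^ n)) \<longlonglongrightarrow> F y"
    using * by simp
  ultimately show ?thesis using LIMSEQ_unique by fastforce
qed

lemma qpoch_inverse_bounded:
  assumes "norm q < 1" "norm x < 1"
  obtains K where "\<And>n. norm (1 / qpoch x q n) \<le> K" "K > 0"
proof -
  have "(\<lambda>n. 1 / qpoch x q n) \<longlonglongrightarrow> 1 / qpoch_inf x q"
    by (intro tendsto_intros qpoch_LIMSEQ qpoch_inf_nonzero_norm assms)
  then have "Bseq (\<lambda>n. 1 / qpoch x q n)"
    by (intro convergent_imp_Bseq convergentI)
  then show ?thesis using that by (auto simp: Bseq_def)
qed

lemma summable_gauss:
  fixes r t :: real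
  assumes "0 \<le> r" "r < 1" "0 \<le> t"
  shows "summable (\<lambda>n. r ^ (n * (n + 1)) * t ^ n)"
proof -
  have "(\<lambda>n. t * r ^ n) \<longlonglongrightarrow> t * 0"
    by (intro tendsto_intros LIMSEQ_power_zero) (use assms in auto)
  then have "eventually (\<lambda>n. t * r ^ n < 1/2) sequentially"
    by (rule order_tendstoD) auto
  then obtain N where N: "\<And>n. n \<ge> N \<Longrightarrow> t * r ^ n < 1/2"
    by (auto simp: eventually_sequentially)
  show ?thesis
  proof (rule summable_ratio_test[of "1/2" N])
    fix n assume "n \<ge> N"
    have "r ^ (2 * n + 2) \<le> r ^ n"
      by (intro power_decreasing) (use assms in auto)
    then have "t * r ^ (2 * n + 2) \<le> 1/2"
      using N[OF \<open>n \<ge> N\<close>] mult_left_mono[OF _ assms(3)] by fastforce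
    then have "(r ^ (n * (n + 1)) * t ^ n) * (t * r ^ (2 * n + 2)) \<le> (r ^ (n * (n + 1)) * t ^ n) * (1/2)"
      by (intro mult_left_mono) (use assms in auto)
    moreover have "r ^ (Suc n * (Suc n + 1)) * t ^ Suc n = (r ^ (n * (n + 1)) * t ^ n) * (t * r ^ (2 * n + 2))"
    proof -
      have "Suc n * (Suc n + 1) = n * (n + 1) + (2 * n + 2)" by simp
      then show ?thesis by (simp only: power_add power_Suc mult_ac)
    qed
    ultimately have "r ^ (Suc n * (Suc n + 1)) * t ^ Suc n \<le> 1/2 * (r ^ (n * (n + 1)) * t ^ n)"
      by linarith
    moreover have "0 \<le> r ^ m * t ^ n'" for m n' using assms by simp
    ultimately show "norm (r ^ (Suc n * (Suc n + 1)) * t ^ Suc n) \<le> 1/2 * norm (r ^ (n * (n + 1)) * t ^ n)"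
      unfolding real_norm_def by (simp only: abs_of_nonneg)
  qed auto
qed

lemma summable_gauss':
  fixes r t :: real
  assumes "0 < r" "r < 1" "0 \<le> t"
  shows "summable (\<lambda>n. r ^ (n * (n - 1)) * t ^ n)"
proof -
  have "summable (\<lambda>n. r ^ (n * (n + 1)) * (t / r\<^sup>2) ^ n)"
    by (intro summable_gauss) (use assms in auto)
  moreover have "r ^ (n * (n + 1)) * (t / r\<^sup>2) ^ n = r ^ (n * (n - 1)) * t ^ n" for n
  proof -
    have "n * (n + 1) = n * (n - 1) + 2 * n" by (cases n) auto
    then show ?thesis using assms by (simp only: power_add power_divide) (simp add: power_mult)
  qed
  ultimately show ?thesis by simp
qed

section \<open>Euler's expansion and the logarithm of an infinite q-product\<close>

lemma abs_summable_Euler: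
  fixes q y :: complex
  assumes "0 < norm q" "norm q < 1"
  shows "summable (\<lambda>k. norm ((-1) ^ k * q ^ (k * (k - 1)) / qpoch (q\<^sup>2) (q\<^sup>2) k * y ^ k))"
proof -
  have q2: "norm (q\<^sup>2) < 1" using assms by (simp add: norm_power power_less_one_iff abs_square_less_1)
  obtain K where K: "\<And>n. norm (1 / qpoch (q\<^sup>2) (q\<^sup>2) n) \<le> K" "K > 0"
    using qpoch_inverse_bounded[OF q2 q2] by blast
  have "summable (\<lambda>k. K * (norm q ^ (k * (k - 1)) * norm y ^ k))"
    by (intro summable_mult summable_gauss') (use assms in auto)
  then show ?thesis
  proof (rule summable_comparison_test')
    fix n
    have "norm (1 / qpoch (q\<^sup>2) (q\<^sup>2) n) * (norm q ^ (n * (n - 1)) * norm y ^ n)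
      \<le> K * (norm q ^ (n * (n - 1)) * norm y ^ n)"
      by (intro mult_right_mono K) auto
    then show "norm (norm ((-1) ^ n * q ^ (n * (n - 1)) / qpoch (q\<^sup>2) (q\<^sup>2) n * y ^ n))
      \<le> K * (norm q ^ (n * (n - 1)) * norm y ^ n)"
      by (simp add: norm_mult norm_divide norm_power mult_ac)
  qed
qed

text \<open>With base q^2 Euler's exponents k(k-1)/2 become the exponents k(k-1) of q. The
  coefficient recursion \<open>rec\<close> is the functional equation F(y) = (1-y) F(y q^2) read off
  term by term.\<close>

theorem qpoch_inf_Euler:
  fixes q y :: complex
  assumes "0 < norm q" "norm q < 1"
  shows "(\<lambda>k. (-1) ^ k * q ^ (k * (k - 1)) / qpoch (q\<^sup>2) (q\<^sup>2) k * y ^ k) sums qpoch_inf y (q\<^sup>2)"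
proof -
  define c where "c = (\<lambda>k. (-1) ^ k * q ^ (k * (k - 1)) / qpoch (q\<^sup>2) (q\<^sup>2) k)"
  define F where "F = (\<lambda>y. \<Sum>k. c k * y ^ k)"
  have q2: "norm (q\<^sup>2) < 1" using assms by (simp add: norm_power power_less_one_iff abs_square_less_1)
  have summ: "summable (\<lambda>k. c k * y ^ k)" for y
    using summable_norm_cancel[OF abs_summable_Euler[OF assms, of y]] by (simp add: c_def)
  have rec: "c (Suc k) * (1 - (q\<^sup>2) ^ Suc k) = - c k * (q\<^sup>2) ^ k" for k
  proof -
    have "Suc k * k = k * (k - 1) + 2 * k" by (cases k) auto
    then have "q ^ (Suc k * k) = q ^ (k * (k - 1)) * (q\<^sup>2) ^ k"
      by (simp only: power_add power_mult)
    then show ?thesis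
      using qpoch_nonzero[OF q2 q2, of k] qpoch_nonzero[OF q2 q2, of "Suc k"]
      by (simp add: c_def qpoch_Suc field_simps)
  qed
  have step: "F y = (1 - y) * F (y * q\<^sup>2)" for y
  proof -
    have 1: "F y - F (y * q\<^sup>2) = (\<Sum>k. c k * y ^ k - c k * (y * q\<^sup>2) ^ k)"
      unfolding F_def by (intro suminf_diff summ)
    also have "\<dots> = (\<Sum>k. c k * (1 - (q\<^sup>2) ^ k) * y ^ k)"
      by (simp add: power_mult_distrib algebra_simps)
    also have "\<dots> = (\<Sum>k. c (Suc k) * (1 - (q\<^sup>2) ^ Suc k) * y ^ Suc k)"
    proof -
      have "summable (\<lambda>k. c k * (1 - (q\<^sup>2) ^ k) * y ^ k)"
        using summable_diff[OF summ[of y] summ[of "y * q\<^sup>2"]]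
        by (simp add: power_mult_distrib algebra_simps)
      from suminf_split_head[OF this] show ?thesis by simp
    qed
    also have "\<dots> = (\<Sum>k. - y * (c k * (y * q\<^sup>2) ^ k))"
      unfolding rec by (simp add: power_mult_distrib mult_ac)
    also have "\<dots> = - y * F (y * q\<^sup>2)"
      unfolding F_def by (intro suminf_mult summ)
    finally show ?thesis by (simp add: algebra_simps)
  qed
  have "F y = qpoch_inf y (q\<^sup>2)"
  proof (rule qpoch_inf_unique[OF q2])
    show "F (y * (q\<^sup>2) ^ n) = (1 - y * (q\<^sup>2) ^ n) * F (y * (q\<^sup>2) ^ Suc n)" for n
      using step[of "y * (q\<^sup>2) ^ n"] by (simp add: mult_ac)
    show "isCont F 0"
      unfolding F_def by (rule isCont_powser[OF summ[of 1]]) simp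
    show "F 0 = 1"
      unfolding F_def using powser_zero[of c] by (simp add: c_def)
  qed
  then show ?thesis
    using summable_sums[OF summ[of y]] by (simp add: F_def c_def)
qed

text \<open>The double series of the logarithms log(1 - y q^i) is never rearranged: the power series
  \<open>L\<close> satisfies L(y) - L(y q) = -Ln(1-y), and \<open>qpoch_inf_unique\<close> does the
  rest. The denominators 1 - q^k later exhibit the poles at roots of unity.\<close>

lemma
  fixes q y :: complex
  assumes q: "norm q < 1" and y: "norm y < 1"
  shows summable_qpoch_log: "summable (\<lambda>k. y ^ Suc k / (of_nat (Suc k) * (1 - q ^ Suc k)))"
    and qpoch_inf_eq_exp: "qpoch_inf y q = exp (- (\<Sum>k. y ^ Suc k / (of_nat (Suc k) * (1 - q ^ Suc k))))"
proof -
  define c where "c = (\<lambda>k. if k = 0 then 0 else 1 / (of_nat k * (1 - q ^ k)))"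
  define L where "L = (\<lambda>y. \<Sum>k. c k * y ^ k)"
  have nz: "1 - q ^ Suc k \<noteq> 0" for k
    using mult_power_neq_1[OF q q, of k] by simp
  have cb: "norm (c k) \<le> 1 / (1 - norm q)" for k
  proof (cases k)
    case (Suc m)
    have "norm q ^ Suc m \<le> norm q ^ 1" by (rule power_decreasing) (use q in auto)
    then have "1 - norm q \<le> norm (1 - q ^ Suc m)"
      using norm_triangle_ineq2[of 1 "q ^ Suc m"] by (simp add: norm_power norm_mult)
    moreover have "1 * norm (1 - q ^ Suc m) \<le> of_nat (Suc m) * norm (1 - q ^ Suc m)"
      by (intro mult_right_mono) auto
    ultimately have "1 / (of_nat (Suc m) * norm (1 - q ^ Suc m)) \<le> 1 / (1 - norm q)"
      using q by (intro divide_left_mono mult_pos_pos) (auto simp: nz simp del: power_Suc of_nat_Suc)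
    then show ?thesis using Suc by (simp add: c_def norm_divide norm_mult del: power_Suc of_nat_Suc)
  qed (use q in \<open>auto simp: c_def\<close>)
  have summ: "summable (\<lambda>k. c k * y ^ k)" if "norm y < 1" for y
  proof (rule summable_comparison_test')
    show "summable (\<lambda>k. 1 / (1 - norm q) * norm y ^ k)"
      by (intro summable_mult summable_geometric) (use that in auto)
    show "norm (c n * y ^ n) \<le> 1 / (1 - norm q) * norm y ^ n" for n
      unfolding norm_mult norm_power by (intro mult_right_mono cb) auto
  qed
  have nyq: "norm (y * q) < 1" if "norm y < 1" for y
    using mult_le_one[of "norm y" "norm q"] that q mult_strict_mono[of "norm y" 1 "norm q" 1]
    by (auto simp: norm_mult)
  have step: "exp (- L y) = (1 - y) * exp (- L (y * q))" if "norm y < 1" for y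
  proof -
    have "(\<lambda>n. (-1) ^ Suc n / of_nat n * (- y) ^ n) sums Ln (1 + (- y))"
      using Ln_series[of "- y"] that by simp
    then have "(\<lambda>n. - ((-1) ^ Suc n / of_nat n * (- y) ^ n)) sums - Ln (1 - y)"
      using sums_minus by fastforce
    moreover have "- ((-1) ^ Suc n / of_nat n * (- y) ^ n) = y ^ n / of_nat n" for n
    proof -
      have "(-1) ^ n * (- y) ^ n = y ^ n" by (subst power_mult_distrib[symmetric]) simp
      then show ?thesis by simp
    qed
    ultimately have 1: "(\<lambda>n. y ^ n / of_nat n) sums - Ln (1 - y)" by (simp only:)
    have "(\<lambda>n. c n * y ^ n - c n * (y * q) ^ n) sums (L y - L (y * q))"
      unfolding L_def by (intro sums_diff summable_sums summ that nyq)
    moreover have "c n * y ^ n - c n * (y * q) ^ n = y ^ n / of_nat n" for n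
    proof (cases n)
      case (Suc m)
      have "c n * y ^ n - c n * (y * q) ^ n = c n * (1 - q ^ n) * y ^ n"
        by (simp add: power_mult_distrib algebra_simps)
      then show ?thesis using Suc nz[of m] by (simp add: c_def)
    qed (auto simp: c_def)
    ultimately have "L y - L (y * q) = - Ln (1 - y)"
      using 1 sums_unique2 by simp
    then have "- L y = Ln (1 - y) + (- L (y * q))" by (simp add: algebra_simps)
    moreover have "1 - y \<noteq> 0" using that by auto
    ultimately show ?thesis by (metis exp_add exp_Ln)
  qed
  have "exp (- L y) = qpoch_inf y q"
  proof (rule qpoch_inf_unique[OF q, of "\<lambda>y. exp (- L y)"])
    show "exp (- L (y * q ^ n)) = (1 - y * q ^ n) * exp (- L (y * q ^ Suc n))" for n
    proof -
      have "norm (y * q ^ n) < 1"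
      proof -
        have "norm y * norm q ^ n \<le> norm y * 1"
          by (intro mult_left_mono power_le_one) (use q in auto)
        then show ?thesis using y by (simp add: norm_mult norm_power)
      qed
      from step[OF this] show ?thesis by (simp add: mult_ac)
    qed
    have "summable (\<lambda>k. c k * (1/2) ^ k)" by (rule summ) simp
    then have "isCont L 0"
      unfolding L_def by (rule isCont_powser) simp
    then show "isCont (\<lambda>y. exp (- L y)) 0" by (intro continuous_intros)
    show "exp (- L 0) = 1"
      unfolding L_def using powser_zero[of c] by (simp add: c_def)
  qed
  moreover have "L y = (\<Sum>k. c (Suc k) * y ^ Suc k)"
    unfolding L_def using suminf_split_head[OF summ[OF y]] by (simp add: c_def)
  ultimately show "qpoch_inf y q = exp (- (\<Sum>k. y ^ Suc k / (of_nat (Suc k) * (1 - q ^ Suc k))))"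
    by (simp add: c_def mult_ac del: power_Suc of_nat_Suc)
  have "summable (\<lambda>k. c (Suc k) * y ^ Suc k)" by (subst summable_Suc_iff) (rule summ[OF y])
  then show "summable (\<lambda>k. y ^ Suc k / (of_nat (Suc k) * (1 - q ^ Suc k)))"
    by (simp add: c_def mult_ac del: power_Suc of_nat_Suc)
qed

section \<open>Double series over the integers\<close>

lemma has_sum_product:
  fixes f :: "'a \<Rightarrow> complex" and g :: "'b \<Rightarrow> complex"
  assumes "(\<lambda>x. norm (f x)) summable_on A" "(\<lambda>x. norm (g x)) summable_on B"
    and f: "(f has_sum a) A" and g: "(g has_sum b) B"
  shows "((\<lambda>(x, y). f x * g y) has_sum a * b) (A \<times> B)"
    and "(\<lambda>(x, y). norm (f x * g y)) summable_on A \<times> B"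
proof -
  show s: "(\<lambda>(x, y). norm (f x * g y)) summable_on A \<times> B"
  proof (rule summable_on_SigmaI)
    show "((\<lambda>y. case (x, y) of (x, y) \<Rightarrow> norm (f x * g y)) has_sum norm (f x) * (\<Sum>\<^sub>\<infinity>y\<in>B. norm (g y))) B" for x
      unfolding split norm_mult by (intro has_sum_cmult_right has_sum_infsum assms)
    show "(\<lambda>x. norm (f x) * (\<Sum>\<^sub>\<infinity>y\<in>B. norm (g y))) summable_on A"
      by (intro summable_on_cmult_left assms)
  qed auto
  have "(\<lambda>z. case z of (x, y) \<Rightarrow> f x * g y) summable_on A \<times> B"
    by (rule abs_summable_summable) (use s in \<open>simp add: case_prod_unfold\<close>)
  then show "((\<lambda>(x, y). f x * g y) has_sum a * b) (A \<times> B)"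
    by (intro has_sum_SigmaI[where g = "\<lambda>x. f x * b"])
       (auto intro!: has_sum_cmult_left has_sum_cmult_right f g)
qed

lemma summable_on_product_nonneg:
  fixes f :: "'a \<Rightarrow> real" and g :: "'b \<Rightarrow> real"
  assumes "f summable_on A" "g summable_on B" "\<And>x. f x \<ge> 0" "\<And>x. g x \<ge> 0"
  shows "(\<lambda>(x, y). f x * g y) summable_on A \<times> B"
proof (rule summable_on_SigmaI)
  show "((\<lambda>y. case (x, y) of (x, y) \<Rightarrow> f x * g y) has_sum f x * (\<Sum>\<^sub>\<infinity>y\<in>B. g y)) B" for x
    unfolding split by (intro has_sum_cmult_right has_sum_infsum assms)
  show "(\<lambda>x. f x * (\<Sum>\<^sub>\<infinity>y\<in>B. g y)) summable_on A"
    by (intro summable_on_cmult_left assms)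
qed (use assms in auto)

lemma has_sum_int_split:
  fixes f :: "int \<Rightarrow> 'a :: topological_comm_monoid_add"
  assumes "((\<lambda>n. f (int n)) has_sum a) UNIV" "((\<lambda>n. f (- 1 - int n)) has_sum b) UNIV"
  shows "(f has_sum a + b) UNIV"
proof -
  have "(f has_sum a) {0..}"
    using assms(1)
    by (subst (asm) has_sum_reindex_bij_witness[where i = nat and j = int and T = "{0..}" and h = f and s' = a]) auto
  moreover have "(f has_sum b) {..<0}"
    using assms(2)
    by (subst (asm) has_sum_reindex_bij_witness[where i = "\<lambda>n. nat (- 1 - n)" and j = "\<lambda>n. - 1 - int n"
          and T = "{..<0}" and h = f and s' = b]) auto
  ultimately have "(f has_sum a + b) ({0..} \<union> {..<0})"
    by (intro has_sum_Un_disjoint) auto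
  moreover have "{0..} \<union> {..<0} = (UNIV :: int set)" by auto
  ultimately show ?thesis by simp
qed

lemma has_sum_int_nonneg:
  fixes f :: "int \<Rightarrow> 'a :: topological_comm_monoid_add"
  shows "(f has_sum a) {0..} \<longleftrightarrow> ((\<lambda>n. f (int n)) has_sum a) UNIV"
  by (rule has_sum_reindex_bij_witness[where i = int and j = nat]) auto

lemma has_sum_int_neg:
  fixes f :: "int \<Rightarrow> 'a :: topological_comm_monoid_add"
  shows "(f has_sum a) {..<0} \<longleftrightarrow> ((\<lambda>n. f (- 1 - int n)) has_sum a) UNIV"
  by (rule has_sum_reindex_bij_witness[where i = "\<lambda>n. - 1 - int n" and j = "\<lambda>n. nat (- 1 - n)"]) auto

text \<open>The exponent n(n+1) is invariant under n -> -1-n, so the negative half is the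
  nonnegative half with \<open>t\<close> inverted, up to a constant.\<close>

lemma summable_on_gauss:
  fixes r t :: real
  assumes r: "0 < r" "r < 1" and t: "0 < t"
  shows "(\<lambda>n::int. r powi (n * (n + 1)) * t powi n) summable_on UNIV"
proof -
  define f where "f = (\<lambda>n::int. r powi (n * (n + 1)) * t powi n)"
  have pos: "r ^ m * s ^ n \<ge> 0" if "s > 0" for s m n using r that by simp
  have fpos: "f (int n) = r ^ (n * (n + 1)) * t ^ n" for n
  proof -
    have "int n * (int n + 1) = int (n * (n + 1))" by (simp add: algebra_simps)
    then show ?thesis unfolding f_def by (simp only: power_int_of_nat)
  qed
  have fneg: "f (- 1 - int n) = inverse t * (r ^ (n * (n + 1)) * (inverse t) ^ n)" for n
  proof -
    have 1: "(- 1 - int n) * (- 1 - int n + 1) = int (n * (n + 1))" by (simp add: algebra_simps)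
    have 2: "- 1 - int n = - int (Suc n)" by simp
    have "f (- 1 - int n) = r powi int (n * (n + 1)) * t powi (- int (Suc n))"
      unfolding f_def 1 unfolding 2 by simp
    then show ?thesis by (simp only: power_int_of_nat power_int_minus power_Suc) (simp add: power_inverse)
  qed
  have "(\<lambda>n. f (int n)) summable_on UNIV"
    unfolding fpos by (rule norm_summable_imp_summable_on)
      (use summable_gauss[of r t] r t pos in \<open>simp add: abs_mult\<close>)
  moreover have "(\<lambda>n. f (- 1 - int n)) summable_on UNIV"
    unfolding fneg by (intro summable_on_cmult_right norm_summable_imp_summable_on)
      (use summable_gauss[of r "inverse t"] r t pos in \<open>simp add: abs_mult\<close>)
  ultimately show ?thesis
    unfolding f_def[symmetric] using has_sum_int_split[of f] by (meson summable_on_def)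
qed

text \<open>Passing to half sum and half difference turns a^2 + b^2 into a sum of separate squares,
  but it reaches only pairs with b - a even; the other coset needs the shift by 1.\<close>

lemma has_sum_int_parity:
  fixes f :: "int \<Rightarrow> int \<Rightarrow> complex"
  assumes "((\<lambda>(e, m). f (m - e) (m + e)) has_sum A) UNIV"
    and "((\<lambda>(e, m). f (m - e) (m + e - 1)) has_sum B) UNIV"
  shows "((\<lambda>(a, b). f a b) has_sum A + B) UNIV"
proof -
  let ?E = "{(a, b). even (b - a :: int)}" and ?O = "{(a, b). odd (b - a :: int)}"
  have ev: "(b - a) div 2 + (a + b) div 2 = b" "(a + b) div 2 - (b - a) div 2 = a" if "even (b - a)" for a b :: int
    using that by presburger+
  have od: "(a + b) div 2 - (b - a) div 2 = a" "1 + ((a + b) div 2 + (b - a) div 2) = b" if "odd (b - a)" for a b :: int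
    using that by presburger+
  have "((\<lambda>(a, b). f a b) has_sum A) ?E"
    using assms(1)
    by (subst has_sum_reindex_bij_witness[where i = "\<lambda>(e, m). (m - e, m + e)"
          and j = "\<lambda>(a, b). ((b - a) div 2, (a + b) div 2)" and T = UNIV
          and h = "\<lambda>(e, m). f (m - e) (m + e)" and s' = A])
       (auto simp: ev add.commute[of "(_ + _) div 2" "(_ - _) div 2"])
  moreover have "((\<lambda>(a, b). f a b) has_sum B) ?O"
    using assms(2)
    by (subst has_sum_reindex_bij_witness[where i = "\<lambda>(e, m). (m - e, m + e - 1)"
          and j = "\<lambda>(a, b). ((b - a + 1) div 2, (a + b + 1) div 2)" and T = UNIV
          and h = "\<lambda>(e, m). f (m - e) (m + e - 1)" and s' = B]) (auto simp: od)
  ultimately have "((\<lambda>(a, b). f a b) has_sum A + B) (?E \<union> ?O)"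
    by (intro has_sum_Un_disjoint) auto
  moreover have "?E \<union> ?O = UNIV" by auto
  ultimately show ?thesis by simp
qed


section \<open>Jacobi's triple product and a bilateral series\<close>

text \<open>A locale, because the results are needed at several bases: at q, at q^2 for the theta
  functions of base q^4, and at r\<zeta> in the limit.\<close>

locale nome =
  fixes q :: complex
  assumes q_pos: "0 < norm q" and q_less_1: "norm q < 1"
begin

lemma q_nonzero: "q \<noteq> 0" using q_pos by auto

lemma q2_less_1: "norm (q\<^sup>2) < 1"
  using q_less_1 by (simp add: norm_power power_less_one_iff abs_square_less_1)

lemma powi_mult: "q powi m * q powi n = q powi (m + n)"
  using q_nonzero by (simp add: power_int_add)

lemma powi_mult': "q powi m * (q powi n * z) = q powi (m + n) * z"
  using q_nonzero by (simp add: power_int_add)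

abbreviation J :: complex where "J \<equiv> qpoch_inf (q\<^sup>2) (q\<^sup>2)"

lemma J_nonzero: "J \<noteq> 0"
  using qpoch_inf_nonzero_norm q2_less_1 by blast

text \<open>Extending \<open>1 / (q\<^sup>2; q\<^sup>2)\<^sub>n\<close> by \<open>0\<close> to negative \<open>n\<close> keeps \<open>R_rec\<close> valid for all integers.\<close>
definition R :: "int \<Rightarrow> complex" where
  "R n = (if n < 0 then 0 else 1 / qpoch (q\<^sup>2) (q\<^sup>2) (nat n))"

lemma R_neg [simp]: "n < 0 \<Longrightarrow> R n = 0" by (simp add: R_def)

lemma R_of_nat: "R (int n) = 1 / qpoch (q\<^sup>2) (q\<^sup>2) n" by (simp add: R_def)

lemma R_0 [simp]: "R 0 = 1" by (simp add: R_def)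

lemma R_rec: "R (n - 1) = R n * (1 - q powi (2 * n))"
proof (cases "n \<ge> 1")
  case True
  then obtain m where m: "n = int (Suc m)"
    by (metis Suc_pred' int_eq_iff nat_0_le of_nat_1 of_nat_le_iff less_eq_Suc_le One_nat_def
        order_trans zero_le_one)
  have "R (n - 1) = 1 / qpoch (q\<^sup>2) (q\<^sup>2) m" unfolding m using R_of_nat[of m] by simp
  moreover have "R n = 1 / (qpoch (q\<^sup>2) (q\<^sup>2) m * (1 - q\<^sup>2 * (q\<^sup>2) ^ m))"
    unfolding m R_of_nat qpoch_Suc ..
  moreover have "q powi (2 * n) = q\<^sup>2 * (q\<^sup>2) ^ m"
    unfolding m by (metis power_Suc power_int_mult power_int_numeral power_int_of_nat)
  ultimately show ?thesis
    using mult_power_neq_1[OF q2_less_1 q2_less_1, of m] by simp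
next
  case False
  then show ?thesis by (cases "n = 0") auto
qed

lemma R_bounded: obtains K where "\<And>n. norm (R n) \<le> K" "K > 0"
proof -
  obtain K where K: "\<And>n. norm (1 / qpoch (q\<^sup>2) (q\<^sup>2) n) \<le> K" "K > 0"
    using qpoch_inverse_bounded[OF q2_less_1 q2_less_1] by blast
  then have "norm (R n) \<le> K" for n by (simp add: R_def)
  then show ?thesis using that K by blast
qed

lemma R_LIMSEQ: "(\<lambda>n. R (int n + d)) \<longlonglongrightarrow> 1 / J"
proof -
  have *: "(\<lambda>n. R (int n)) \<longlonglongrightarrow> 1 / J"
    unfolding R_of_nat by (intro tendsto_intros qpoch_LIMSEQ J_nonzero q2_less_1)
  show ?thesis
  proof (cases "d \<ge> 0")
    case True
    then show ?thesis
      using LIMSEQ_ignore_initial_segment[OF *, of "nat d"] by simp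
  next
    case False
    have "(\<lambda>n. R (int (n + nat (- d)) + d)) \<longlonglongrightarrow> 1 / J"
      using * False by simp
    then show ?thesis by (rule LIMSEQ_offset)
  qed
qed

section \<open>The Durfee rectangle identity\<close>

definition durfee_term :: "nat \<Rightarrow> nat \<Rightarrow> complex" where
  "durfee_term d l = q ^ (2 * (l * l + l * d)) * R (int l) * R (int l + int d)"

lemma durfee_term_bound:
  assumes "\<And>n. norm (R n) \<le> K" "K > 0"
  shows "norm (durfee_term d l) \<le> K * K * norm q ^ l"
proof -
  have "norm q ^ (2 * (l * l + l * d)) \<le> norm q ^ l"
    using q_less_1 by (intro power_decreasing) (auto simp: algebra_simps intro: order_trans[OF le_square])
  then have "norm q ^ (2 * (l * l + l * d)) * norm (R (int l)) * norm (R (int l + int d)) \<le> norm q ^ l * K * K"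
    by (intro mult_mono assms) (use assms in auto)
  then show ?thesis unfolding durfee_term_def norm_mult norm_power by (simp add: mult_ac)
qed

lemma summable_durfee_term: "summable (\<lambda>l. norm (durfee_term d l))"
proof -
  obtain K where K: "\<And>n. norm (R n) \<le> K" "K > 0" using R_bounded by blast
  have "summable (\<lambda>l. K * K * norm q ^ l)"
    using q_less_1 by (intro summable_mult summable_geometric) auto
  then show ?thesis
    by (rule summable_comparison_test') (use durfee_term_bound[OF K] in auto)
qed

lemma summable_durfee_term': "summable (durfee_term d)"
  using summable_norm_cancel[OF summable_durfee_term] .

text \<open>Tannery's theorem: a term with l > 0 carries q^(2ld) and dies out, the term l = 0 tends
  to 1/J, and the majorant is independent of d.\<close>

lemma durfee_LIMSEQ: "(\<lambda>d. suminf (durfee_term d)) \<longlonglongrightarrow> 1 / J"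
proof -
  obtain K where K: "\<And>n. norm (R n) \<le> K" "K > 0" using R_bounded by blast
  have lim: "(\<lambda>d. durfee_term d l) \<longlonglongrightarrow> (if l = 0 then 1 / J else 0)" for l
  proof (cases "l = 0")
    case True
    then show ?thesis using R_LIMSEQ[of 0] by (simp add: durfee_term_def)
  next
    case False
    have "(\<lambda>d. (q ^ (2 * (l * l)) * R (int l)) * (q ^ (2 * l)) ^ d * R (int d + int l)) \<longlonglongrightarrow>
      (q ^ (2 * (l * l)) * R (int l)) * 0 * (1 / J)"
      using False q_less_1
      by (intro tendsto_intros LIMSEQ_power_zero R_LIMSEQ) (auto simp: norm_power power_less_one_iff)
    moreover have "durfee_term d l = (q ^ (2 * (l * l)) * R (int l)) * (q ^ (2 * l)) ^ d * R (int d + int l)" for d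
    proof -
      have "q ^ (2 * (l * l + l * d)) = q ^ (2 * (l * l)) * (q ^ (2 * l)) ^ d"
        unfolding power_mult[symmetric] power_add[symmetric] by (simp add: algebra_simps)
      then show ?thesis unfolding durfee_term_def by (simp only: mult_ac add.commute)
    qed
    ultimately show ?thesis using False by simp
  qed
  have "summable (\<lambda>l. K * K * norm q ^ l)"
    using q_less_1 by (intro summable_mult summable_geometric) auto
  then have "(\<lambda>d. \<Sum>l. durfee_term d l) \<longlonglongrightarrow> (\<Sum>l. if l = 0 then 1 / J else 0)"
    using tannerys_theorem[OF lim, where M = "\<lambda>l. K * K * norm q ^ l"] durfee_term_bound[OF K]
    by (auto simp: case_prod_unfold)
  moreover have "(\<Sum>l::nat. if l = 0 then 1 / J else 0) = 1 / J"
    using sums_single[of 0 "\<lambda>_. 1 / J"] by (simp add: sums_iff)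
  ultimately show ?thesis by simp
qed

text \<open>
  The difference at \<open>d\<close> is \<open>- q\<^sup>2\<^sup>d\<^sup>+\<^sup>2\<close> times the difference at \<open>d + 1\<close>; as the differences
  tend to \<open>0\<close>, they all vanish, and the sum equals its limit for \<open>d \<longlonglongrightarrow> \<infinity>\<close>.
\<close>
lemma durfee_rectangle: "suminf (durfee_term d) = 1 / J"
proof -
  define D where "D = (\<lambda>d. suminf (durfee_term d))"
  have rec: "D d - D (Suc d) = q ^ (2 * (d + 1)) * (D (Suc (Suc d)) - D (Suc d))" for d
  proof -
    \<comment> \<open>\<open>R_rec\<close> lowers the index of either factor; the bracket (1 -
      q^(2l+2d+2)) - q^(2l) of the difference is regrouped as (1 - q^(2l)) - q^(2l+2d+2). Its first
      part gives \<open>u\<close>, which vanishes at l = 0 and, shifted by one, is a multiple of the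
      summand for d + 2.\<close>
    define u where "u = (\<lambda>l. q ^ (2 * (l * l + l * d)) * R (int l - 1) * R (int l + int d + 1))"
    have t: "durfee_term d l - durfee_term (Suc d) l = u l - q ^ (2 * (d + 1)) * durfee_term (Suc d) l" for l
    proof -
      have e: "q powi (2 * int l) = q ^ (2 * l)" "q powi (2 * (int l + int d + 1)) = q ^ (2 * (l + d + 1))"
      proof -
        have "2 * int l = int (2 * l)" "2 * (int l + int d + 1) = int (2 * (l + d + 1))" by simp_all
        then show "q powi (2 * int l) = q ^ (2 * l)" "q powi (2 * (int l + int d + 1)) = q ^ (2 * (l + d + 1))"
          by (simp_all only: power_int_of_nat)
      qed
      have r: "R (int l + int d) = R (int l + int d + 1) * (1 - q ^ (2 * (l + d + 1)))"
        using R_rec[of "int l + int d + 1"] unfolding e by simp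
      have r': "R (int l - 1) = R (int l) * (1 - q ^ (2 * l))"
        using R_rec[of "int l"] unfolding e by simp
      have i: "int l + int (Suc d) = int l + int d + 1" by simp
      have e1: "q ^ (2 * (l * l + l * Suc d)) = q ^ (2 * (l * l + l * d)) * q ^ (2 * l)"
        by (subst power_add[symmetric]) (simp add: algebra_simps)
      have e2: "q ^ (2 * (l + d + 1)) = q ^ (2 * l) * q ^ (2 * (d + 1))"
        by (subst power_add[symmetric]) (simp add: algebra_simps)
      show ?thesis
        unfolding durfee_term_def u_def i r r' e1 e2 by (simp only: ring_distribs mult_ac) simp
    qed
    have us: "summable u"
    proof -
      have "u = (\<lambda>l. durfee_term d l - durfee_term (Suc d) l + q ^ (2 * (d + 1)) * durfee_term (Suc d) l)"
        using t by (simp add: fun_eq_iff)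
      then show ?thesis
        by (auto intro!: summable_add summable_diff summable_mult summable_durfee_term')
    qed
    have u0: "u 0 = 0" by (simp add: u_def)
    have uS: "u (Suc l) = q ^ (2 * (d + 1)) * durfee_term (Suc (Suc d)) l" for l
    proof -
      have "q ^ (2 * (Suc l * Suc l + Suc l * d)) = q ^ (2 * (d + 1)) * q ^ (2 * (l * l + l * Suc (Suc d)))"
        by (subst power_add[symmetric]) (simp add: algebra_simps)
      moreover have "int (Suc l) - 1 = int l" "int (Suc l) + int d + 1 = int l + int (Suc (Suc d))"
        by simp_all
      ultimately show ?thesis unfolding u_def durfee_term_def by (simp only: mult_ac)
    qed
    have "D d - D (Suc d) = (\<Sum>l. u l - q ^ (2 * (d + 1)) * durfee_term (Suc d) l)"
      unfolding D_def t[symmetric] by (intro suminf_diff summable_durfee_term')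
    also have "\<dots> = (\<Sum>l. u l) - (\<Sum>l. q ^ (2 * (d + 1)) * durfee_term (Suc d) l)"
      by (intro suminf_diff[symmetric] summable_mult summable_durfee_term' us)
    also have "(\<Sum>l. u l) = (\<Sum>l. q ^ (2 * (d + 1)) * durfee_term (Suc (Suc d)) l)"
      using suminf_split_head[OF us] u0 uS by simp
    also have "\<dots> = q ^ (2 * (d + 1)) * D (Suc (Suc d))"
      unfolding D_def by (intro suminf_mult summable_durfee_term')
    also have "(\<Sum>l. q ^ (2 * (d + 1)) * durfee_term (Suc d) l) = q ^ (2 * (d + 1)) * D (Suc d)"
      unfolding D_def by (intro suminf_mult summable_durfee_term')
    finally show ?thesis by (simp add: algebra_simps)
  qed
  have D: "D \<longlonglongrightarrow> 1 / J" unfolding D_def by (rule durfee_LIMSEQ)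
  have dec: "norm (D d - D (Suc d)) \<le> norm (D (d + m) - D (Suc (d + m)))" for d m
  proof (induction m)
    case (Suc m)
    have "norm (D (d + m) - D (Suc (d + m))) =
        norm q ^ (2 * (d + m + 1)) * norm (D (Suc (d + m)) - D (Suc (Suc (d + m))))"
      by (subst rec) (simp only: norm_mult norm_power, simp add: norm_minus_commute)
    also have "\<dots> \<le> 1 * norm (D (Suc (d + m)) - D (Suc (Suc (d + m))))"
      by (intro mult_right_mono power_le_one) (use q_less_1 in auto)
    finally show ?case using Suc by simp
  qed simp
  have const: "D d = D (Suc d)" for d
  proof -
    have "(\<lambda>m. D (m + d) - D (m + Suc d)) \<longlonglongrightarrow> 1 / J - 1 / J"
      by (intro tendsto_diff LIMSEQ_ignore_initial_segment D)
    then have "(\<lambda>m. norm (D (d + m) - D (Suc (d + m)))) \<longlonglongrightarrow> 0"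
      using tendsto_norm_zero by (fastforce simp: add.commute)
    then have "norm (D d - D (Suc d)) \<le> 0"
      by (rule LIMSEQ_le_const) (use dec in blast)
    then show ?thesis by simp
  qed
  have "D n = D 0" for n by (induction n) (simp_all flip: const)
  then have "D = (\<lambda>n. D d)" by metis
  then have "(\<lambda>n. D d) \<longlonglongrightarrow> 1 / J" using D by metis
  then have "D d = 1 / J" by (simp add: LIMSEQ_const_iff)
  then show ?thesis by (simp add: D_def)
qed


section \<open>Jacobi's triple product from two Euler expansions\<close>

lemma Euler_has_sum:
  shows "((\<lambda>k::nat. q powi (int k * (int k - 1)) * (- x) powi int k * R (int k)) has_sum qpoch_inf x (q\<^sup>2)) UNIV"
    and "(\<lambda>k::nat. norm (q powi (int k * (int k - 1)) * (- x) powi int k * R (int k))) summable_on UNIV"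
proof -
  have *: "(-1) ^ k * q ^ (k * (k - 1)) / qpoch (q\<^sup>2) (q\<^sup>2) k * x ^ k =
      q powi (int k * (int k - 1)) * (- x) powi int k * R (int k)" for k
  proof -
    have "int k * (int k - 1) = int (k * (k - 1))" by (cases k) (auto simp: algebra_simps)
    moreover have "(- x) ^ k = (-1) ^ k * x ^ k" by (rule power_minus)
    ultimately show ?thesis by (simp only: R_of_nat power_int_of_nat) simp
  qed
  show "((\<lambda>k::nat. q powi (int k * (int k - 1)) * (- x) powi int k * R (int k)) has_sum qpoch_inf x (q\<^sup>2)) UNIV"
    using norm_summable_imp_has_sum[OF abs_summable_Euler[OF q_pos q_less_1] qpoch_inf_Euler[OF q_pos q_less_1], of x]
    unfolding * .
  show "(\<lambda>k::nat. norm (q powi (int k * (int k - 1)) * (- x) powi int k * R (int k))) summable_on UNIV"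
    using abs_summable_Euler[OF q_pos q_less_1, of x] unfolding *
    by (intro norm_summable_imp_summable_on) simp
qed

text \<open>This sum is the coefficient of \<open>(- z) powi d\<close> in the product of two Euler
  expansions, with k = l + d. The exponent equals d(d-1) + 2l(l+d), so Durfee's identity applies;
  for d < 0 the terms with l < -d vanish, and shifting l by -d interchanges the two factors
  \<open>R\<close>.\<close>

lemma durfee_has_sum:
  "((\<lambda>l::nat. q powi ((int l + d) * (int l + d - 1) + int l * (int l + 1)) * R (int l) * R (int l + d))
     has_sum q powi (d * (d - 1)) / J) UNIV"
proof -
  have D: "((\<lambda>l. q powi (d * (d - 1)) * durfee_term e l) has_sum q powi (d * (d - 1)) * (1 / J)) UNIV" for e
    using norm_summable_imp_has_sum[OF summable_durfee_term summable_sums[OF summable_durfee_term']]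
    unfolding durfee_rectangle by (rule has_sum_cmult_right)
  have t: "durfee_term e l = q powi (2 * (int l * int l + int l * int e)) * R (int l) * R (int l + int e)" for e l
  proof -
    have "2 * (int l * int l + int l * int e) = int (2 * (l * l + l * e))" by simp
    then show ?thesis unfolding durfee_term_def by (simp only: power_int_of_nat)
  qed
  show ?thesis
  proof (cases "d \<ge> 0")
    case True
    then obtain e where e: "d = int e" by (metis nat_0_le)
    have "q powi ((int l + d) * (int l + d - 1) + int l * (int l + 1)) * R (int l) * R (int l + d) =
        q powi (d * (d - 1)) * durfee_term e l" for l
      unfolding t e by (simp add: powi_mult' powi_mult mult.assoc, simp add: algebra_simps)
    then show ?thesis using D[of e] by simp
  next
    case False
    then obtain e where e: "d = - int e" by (metis nat_0_le linear neg_0_le_iff_le minus_minus)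
    have eq: "q powi ((int (m + e) + d) * (int (m + e) + d - 1) + int (m + e) * (int (m + e) + 1)) * R (int (m + e)) * R (int (m + e) + d) =
        q powi (d * (d - 1)) * durfee_term e m" for m
      unfolding t e by (simp add: powi_mult' powi_mult mult.assoc, simp add: algebra_simps)
    have eq': "q powi (d * (d - 1)) * durfee_term e (l - e) =
        q powi ((int l + d) * (int l + d - 1) + int l * (int l + 1)) * R (int l) * R (int l + d)" if "e \<le> l" for l
      using eq[of "l - e"] that by (simp only: le_add_diff_inverse2)
    have "((\<lambda>l::nat. q powi ((int l + d) * (int l + d - 1) + int l * (int l + 1)) * R (int l) * R (int l + d))
     has_sum q powi (d * (d - 1)) / J) {e..}"
      using D[of e]
      by (subst has_sum_reindex_bij_witness[where i = "\<lambda>m. m + e" and j = "\<lambda>l. l - e" and T = UNIV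
            and h = "\<lambda>m. q powi (d * (d - 1)) * durfee_term e m" and s' = "q powi (d * (d - 1)) * (1 / J)"])
         (auto simp: eq')
    then show ?thesis
      by (rule has_sum_cong_neutral[THEN iffD1, rotated -1]) (auto simp: e)
  qed
qed

theorem jacobi_triple_product:
  assumes z: "z \<noteq> 0"
  shows "((\<lambda>n. q powi (n * (n - 1)) * (- z) powi n) has_sum jtheta z (q\<^sup>2)) UNIV"
proof -
  define h where "h = (\<lambda>(d, l::nat). (- z) powi d *
    (q powi ((int l + d) * (int l + d - 1) + int l * (int l + 1)) * R (int l) * R (int l + d)))"
  have "((\<lambda>(k::nat, l::nat). (q powi (int k * (int k - 1)) * (- z) powi int k * R (int k)) *
      (q powi (int l * (int l - 1)) * (- (q\<^sup>2 / z)) powi int l * R (int l)))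
      has_sum (qpoch_inf z (q\<^sup>2) * qpoch_inf (q\<^sup>2 / z) (q\<^sup>2))) (UNIV \<times> UNIV)"
    by (intro has_sum_product Euler_has_sum)
  also have "?this \<longleftrightarrow> (h has_sum (qpoch_inf z (q\<^sup>2) * qpoch_inf (q\<^sup>2 / z) (q\<^sup>2))) {(d, l). int l + d \<ge> 0}"
  proof (rule has_sum_reindex_bij_witness[where i = "\<lambda>(d, l). (nat (int l + d), l)" and j = "\<lambda>(k, l). (int k - int l, l)"])
    fix kl :: "nat \<times> nat"
    obtain k l where kl: "kl = (k, l)" by force
    have "(- (q\<^sup>2 / z)) powi int l = q powi (2 * int l) * (- z) powi (- int l)"
    proof -
      have "- (q\<^sup>2 / z) = q\<^sup>2 * inverse (- z)" by (simp add: divide_inverse)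
      then have "(- (q\<^sup>2 / z)) powi int l = (q\<^sup>2) powi int l * inverse (- z) powi int l"
        by (simp only: power_int_mult_distrib)
      also have "(q\<^sup>2) powi int l = q powi (2 * int l)"
        using power_int_power[of q 2 "int l"] by simp
      also have "inverse (- z) powi int l = (- z) powi (- int l)"
        by (simp only: power_int_inverse power_int_minus)
      finally show ?thesis .
    qed
    moreover have "(- z) powi (int k - int l) = (- z) powi int k * (- z) powi (- int l)"
      using z power_int_add[of "- z" "int k" "- int l"] by simp
    ultimately show "h (case kl of (k, l) \<Rightarrow> (int k - int l, l)) =
         (case kl of (k, l) \<Rightarrow> (q powi (int k * (int k - 1)) * (- z) powi int k * R (int k)) *
      (q powi (int l * (int l - 1)) * (- (q\<^sup>2 / z)) powi int l * R (int l)))"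
      unfolding kl h_def split
      by (simp add: powi_mult' powi_mult mult_ac, simp add: algebra_simps)
  qed auto
  also have "\<dots> \<longleftrightarrow> (h has_sum (qpoch_inf z (q\<^sup>2) * qpoch_inf (q\<^sup>2 / z) (q\<^sup>2))) (UNIV \<times> UNIV)"
    by (rule has_sum_cong_neutral) (auto simp: h_def)
  finally have "((\<lambda>d. (- z) powi d * (q powi (d * (d - 1)) / J)) has_sum
      (qpoch_inf z (q\<^sup>2) * qpoch_inf (q\<^sup>2 / z) (q\<^sup>2))) UNIV"
    by (rule has_sum_SigmaD) (unfold h_def split, intro has_sum_cmult_right durfee_has_sum)
  from has_sum_cmult_right[OF this, of J] show ?thesis
    using J_nonzero by (simp add: jtheta_def mult_ac)
qed

text \<open>The inner sum of the bilateral series once \<open>a\<close> and \<open>b\<close> are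
  fixed, with d = b - a. For d >= 0, iterating the recurrence \<open>S_rec\<close> shows that J^2
  \<open>S d\<close> is the partial theta series of (-1)^n q^(n(n+1)+2nd) over n >= 0.\<close>

definition S :: "int \<Rightarrow> complex" where
  "S d = (\<Sum>\<^sub>\<infinity>l::nat. q powi (2 * int l) * R (int l) * R (int l + d))"

lemma S_summand_bound:
  assumes "\<And>n. norm (R n) \<le> K" "K > 0"
  shows "norm (q powi (2 * int l) * R (int l) * R (int l + d)) \<le> K * K * (norm q ^ 2) ^ l"
proof -
  have "norm (q powi (2 * int l)) = (norm q ^ 2) ^ l"
    by (metis norm_power of_nat_mult of_nat_numeral power_int_of_nat power_mult)
  moreover have "(norm q ^ 2) ^ l * norm (R (int l)) * norm (R (int l + d)) \<le> (norm q ^ 2) ^ l * K * K"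
    by (intro mult_mono assms) (use assms in auto)
  ultimately show ?thesis by (simp add: norm_mult mult_ac)
qed

lemma summable_norm_q2: "(\<lambda>l. (norm q ^ 2) ^ l) summable_on (UNIV :: nat set)"
proof -
  have "norm q ^ 2 < 1" using q2_less_1 by (simp add: norm_power)
  then have "summable (\<lambda>l. (norm q ^ 2) ^ l)" by (intro summable_geometric) simp
  then show ?thesis by (subst summable_on_UNIV_nonneg_real_iff) auto
qed

lemma S_abs_summable:
  "(\<lambda>l::nat. norm (q powi (2 * int l) * R (int l) * R (int l + d))) summable_on UNIV"
proof -
  obtain K where K: "\<And>n. norm (R n) \<le> K" "K > 0" using R_bounded by blast
  have "(\<lambda>l::nat. K * K * (norm q ^ 2) ^ l) summable_on UNIV"
    by (intro summable_on_cmult_right summable_norm_q2)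
  then show ?thesis
    by (rule Infinite_Sum.abs_summable_on_comparison_test') (use S_summand_bound[OF K] in auto)
qed

lemma S_has_sum: "((\<lambda>l::nat. q powi (2 * int l) * R (int l) * R (int l + d)) has_sum S d) UNIV"
  unfolding S_def using has_sum_infsum[OF Infinite_Sum.abs_summable_summable[OF S_abs_summable]] .

text \<open>
  Both infinite products are expanded by Euler's formula, with summation indices \<open>k\<close> and \<open>l\<close>;
  the substitution \<open>(a, b) = (n + l, n + k)\<close> separates the variables in the exponent of \<open>q\<close>.
\<close>
lemma bilateral_expansion:
  assumes x: "x \<noteq> 0"
  obtains G where
    "((\<lambda>(a, b). (- x) powi (b - a) * q powi (a * (a + 1) + b * (b + 1)) * S (b - a)) has_sum G) UNIV"
    "((\<lambda>n. q powi (2 * n * (n + 1)) * qpoch_inf (x * q powi (2 * n + 2)) (q\<^sup>2) *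
        qpoch_inf (q powi (2 * n + 4) / x) (q\<^sup>2)) has_sum G) UNIV"
proof -
  \<comment> \<open>The triple series is summed in two ways: over \<open>l\<close> for fixed
    \<open>a\<close> and \<open>b\<close>, giving \<open>S\<close>, and over \<open>k\<close> and
    \<open>l\<close> for fixed n = a - l, giving the infinite products. The factor q^(2l), which
    makes the sum over \<open>l\<close> converge, stems from the exponent 2n+4 standing opposite
    2n+2 in the two products.\<close>
  define h where "h = (\<lambda>((a, b), l::nat). (- x) powi (b - a) * q powi (a * (a + 1) + b * (b + 1)) *
    (q powi (2 * int l) * R (int l) * R (int l + (b - a))))"
  obtain K where K: "\<And>n. norm (R n) \<le> K" "K > 0" using R_bounded by blast
  \<comment> \<open>The norm of \<open>h\<close> is dominated by a product of three functions of one
    variable each: \<open>g1\<close> and \<open>g2\<close> are Gaussian in \<open>a\<close> and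
    \<open>b\<close>, and |q|^(2l) is geometric.\<close>
  define g1 where "g1 = (\<lambda>a. norm q powi (a * (a + 1)) * (inverse (norm x)) powi a)"
  define g2 where "g2 = (\<lambda>b. norm q powi (b * (b + 1)) * (norm x) powi b)"
  have g: "g1 summable_on UNIV" "g2 summable_on UNIV"
    unfolding g1_def g2_def using x q_pos q_less_1 by (auto intro!: summable_on_gauss)
  have g_nonneg: "g1 a \<ge> 0" "g2 a \<ge> 0" for a unfolding g1_def g2_def using x by auto
  have "(\<lambda>(ab, l). (case ab of (a, b) \<Rightarrow> g1 a * g2 b) * (K * K * (norm q ^ 2) ^ l))
      summable_on (UNIV \<times> UNIV) \<times> (UNIV :: nat set)"
    by (intro summable_on_product_nonneg g g_nonneg summable_on_cmult_right summable_norm_q2)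
       (use K g_nonneg in auto)
  then have "(\<lambda>z. norm (h z)) summable_on (UNIV \<times> UNIV) \<times> UNIV"
  proof (rule Infinite_Sum.abs_summable_on_comparison_test')
    fix z :: "(int \<times> int) \<times> nat"
    obtain a b l where z: "z = ((a, b), l)" by (metis surj_pair)
    have "norm ((- x) powi (b - a)) = norm x powi b * inverse (norm x) powi a"
      using x power_int_add[of "norm x" b "- a"] by (simp add: norm_power_int power_int_inverse power_int_minus)
    moreover have "norm (q powi (a * (a + 1) + b * (b + 1))) = norm q powi (a * (a + 1)) * norm q powi (b * (b + 1))"
      using q_nonzero by (simp add: norm_power_int power_int_add norm_mult)
    ultimately have "norm ((- x) powi (b - a) * q powi (a * (a + 1) + b * (b + 1))) = g1 a * g2 b"
      unfolding norm_mult g1_def g2_def by simp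
    then have "norm (h z) = (g1 a * g2 b) * norm (q powi (2 * int l) * R (int l) * R (int l + (b - a)))"
      unfolding h_def z split norm_mult[of "_ * _" "q powi (2 * int l) * R (int l) * R (int l + (b - a))"] by simp
    also have "\<dots> \<le> (g1 a * g2 b) * (K * K * (norm q ^ 2) ^ l)"
      using S_summand_bound[OF K] g_nonneg by (intro mult_left_mono) auto
    finally show "norm (h z) \<le> (case z of (ab, l) \<Rightarrow> (case ab of (a, b) \<Rightarrow> g1 a * g2 b) * (K * K * (norm q ^ 2) ^ l))"
      unfolding z by simp
  qed
  then have "h summable_on (UNIV \<times> UNIV) \<times> UNIV" by (rule Infinite_Sum.abs_summable_summable)
  then obtain G where G: "(h has_sum G) ((UNIV \<times> UNIV) \<times> UNIV)" by (auto simp: summable_on_def)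
  show ?thesis
  proof
    have "((\<lambda>ab. (case ab of (a, b) \<Rightarrow> (- x) powi (b - a) * q powi (a * (a + 1) + b * (b + 1)) * S (b - a))) has_sum G) (UNIV \<times> UNIV)"
      using G
    proof (rule has_sum_SigmaD)
      fix ab :: "int \<times> int"
      obtain a b where ab: "ab = (a, b)" by (cases ab)
      show "((\<lambda>l. h (ab, l)) has_sum (case ab of (a, b) \<Rightarrow> (- x) powi (b - a) * q powi (a * (a + 1) + b * (b + 1)) * S (b - a))) UNIV"
        unfolding h_def ab split by (intro has_sum_cmult_right S_has_sum)
    qed
    then show "((\<lambda>(a, b). (- x) powi (b - a) * q powi (a * (a + 1) + b * (b + 1)) * S (b - a)) has_sum G) UNIV"
      by simp
  next
    define f where "f = (\<lambda>n::int. \<lambda>(k::nat, l::nat). q powi (2 * n * (n + 1)) *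
       ((q powi (int k * (int k - 1)) * (- (x * q powi (2 * n + 2))) powi int k * R (int k)) *
      (q powi (int l * (int l - 1)) * (- (q powi (2 * n + 4) / x)) powi int l * R (int l))))"
    have h0: "h z = 0" if "z \<notin> {((a, b), l). int l + (b - a) \<ge> 0}" for z
    proof -
      obtain a b l where z: "z = ((a, b), l)" by (metis surj_pair)
      have "R (int l + (b - a)) = 0" using that by (intro R_neg) (simp add: z)
      then show ?thesis unfolding z h_def split by (simp only: mult_zero_right)
    qed
    have restrict: "(h has_sum G) ((UNIV \<times> UNIV) \<times> UNIV) \<longleftrightarrow> (h has_sum G) {((a, b), l). int l + (b - a) \<ge> 0}"
      by (rule has_sum_cong_neutral) (use h0 in \<open>blast+\<close>)
    define i :: "int \<times> nat \<times> nat \<Rightarrow> (int \<times> int) \<times> nat"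
      where "i = (\<lambda>(n, k, l). ((n + int l, n + int k), l))"
    define j :: "(int \<times> int) \<times> nat \<Rightarrow> int \<times> nat \<times> nat"
      where "j = (\<lambda>((a, b), l). (a - int l, nat (int l + (b - a)), l))"
    have "(h has_sum G) {((a, b), l). int l + (b - a) \<ge> 0} \<longleftrightarrow> ((\<lambda>(n, kl). f n kl) has_sum G) (UNIV \<times> UNIV)"
    proof (rule has_sum_reindex_bij_witness[where j = j and i = i])
      fix abl :: "(int \<times> int) \<times> nat"
      assume "abl \<in> {((a, b), l). int l + (b - a) \<ge> 0}"
      then obtain a b l where abl: "abl = ((a, b), l)" and "int l + (b - a) \<ge> 0" by blast
      then obtain k where k: "int l + (b - a) = int k" by (metis nat_0_le)
      define n where "n = a - int l"
      have ab: "a = n + int l" "b = n + int k" using k by (auto simp: n_def)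
      have "(- (x * q powi (2 * n + 2))) powi int k = (- x) powi int k * q powi ((2 * n + 2) * int k)"
        by (metis minus_mult_left power_int_mult power_int_mult_distrib)
      moreover have "(- (q powi (2 * n + 4) / x)) powi int l = q powi ((2 * n + 4) * int l) * (- x) powi (- int l)"
      proof -
        have "- (q powi (2 * n + 4) / x) = q powi (2 * n + 4) * inverse (- x)" by (simp add: divide_inverse)
        then have "(- (q powi (2 * n + 4) / x)) powi int l = (q powi (2 * n + 4)) powi int l * inverse (- x) powi int l"
          by (simp only: power_int_mult_distrib)
        then show ?thesis
          by (simp only: power_int_inverse power_int_minus power_int_mult)
      qed
      moreover have "(- x) powi (int k - int l) = (- x) powi int k * (- x) powi (- int l)"
        using x power_int_add[of "- x" "int k" "- int l"] by simp
      moreover have "n + int k - (n + int l) = int k - int l" "int l + (int k - int l) = int k" by simp_all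
      ultimately show "(case j abl of (n, kl) \<Rightarrow> f n kl) = h abl"
        unfolding abl j_def split k n_def[symmetric] nat_int f_def h_def unfolding ab
        by (simp only: powi_mult' powi_mult mult_ac) (simp add: algebra_simps)
      show "i (j abl) = abl" "j abl \<in> UNIV \<times> UNIV"
        using k by (simp_all add: abl i_def j_def)
    next
      fix nkl :: "int \<times> nat \<times> nat"
      obtain n k l where nkl: "nkl = (n, k, l)" by (metis surj_pair)
      show "j (i nkl) = nkl" "i nkl \<in> {((a, b), l). int l + (b - a) \<ge> 0}"
        by (simp_all add: nkl i_def j_def)
    qed (rule refl)
    then have "((\<lambda>(n, kl). f n kl) has_sum G) (UNIV \<times> UNIV)" using G restrict by blast
    then show "((\<lambda>n. q powi (2 * n * (n + 1)) * qpoch_inf (x * q powi (2 * n + 2)) (q\<^sup>2) *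
        qpoch_inf (q powi (2 * n + 4) / x) (q\<^sup>2)) has_sum G) UNIV"
    proof (rule has_sum_SigmaD)
      fix n :: int
      have "((\<lambda>(k::nat, l::nat). (q powi (int k * (int k - 1)) * (- (x * q powi (2 * n + 2))) powi int k * R (int k)) *
         (q powi (int l * (int l - 1)) * (- (q powi (2 * n + 4) / x)) powi int l * R (int l)))
         has_sum (qpoch_inf (x * q powi (2 * n + 2)) (q\<^sup>2) * qpoch_inf (q powi (2 * n + 4) / x) (q\<^sup>2))) (UNIV \<times> UNIV)"
        by (intro has_sum_product Euler_has_sum)
      from has_sum_cmult_right[OF this, of "q powi (2 * n * (n + 1))"]
      show "((\<lambda>kl. case (n, kl) of (n, kl) \<Rightarrow> f n kl) has_sum q powi (2 * n * (n + 1)) * qpoch_inf (x * q powi (2 * n + 2)) (q\<^sup>2) *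
        qpoch_inf (q powi (2 * n + 4) / x) (q\<^sup>2)) UNIV"
        unfolding f_def split by (simp add: case_prod_unfold mult.assoc)
    qed
  qed
qed

end

lemma qpoch_inf_mult_minus:
  assumes "norm p < 1"
  shows "qpoch_inf x p * qpoch_inf (- x) p = qpoch_inf (x\<^sup>2) (p\<^sup>2)"
proof (rule LIMSEQ_unique)
  have "qpoch x p n * qpoch (- x) p n = qpoch (x\<^sup>2) (p\<^sup>2) n" for n
    unfolding qpoch_def prod.distrib[symmetric]
    by (rule prod.cong) (simp_all add: algebra_simps power2_eq_square power_mult_distrib)
  then show "(\<lambda>n. qpoch (x\<^sup>2) (p\<^sup>2) n) \<longlonglongrightarrow> qpoch_inf x p * qpoch_inf (- x) p"
    using tendsto_mult[OF qpoch_LIMSEQ[OF assms, of x] qpoch_LIMSEQ[OF assms, of "- x"]] by simp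
  have "norm (p\<^sup>2) < 1" using assms by (simp add: norm_power abs_square_less_1)
  then show "(\<lambda>n. qpoch (x\<^sup>2) (p\<^sup>2) n) \<longlonglongrightarrow> qpoch_inf (x\<^sup>2) (p\<^sup>2)" by (rule qpoch_LIMSEQ)
qed

lemma qpoch_inf_even_odd:
  assumes "norm p < 1"
  shows "qpoch_inf x p = qpoch_inf x (p\<^sup>2) * qpoch_inf (x * p) (p\<^sup>2)"
proof (rule LIMSEQ_unique)
  have p2: "norm (p\<^sup>2) < 1" using assms by (simp add: norm_power abs_square_less_1)
  have "qpoch x p (2 * n) = qpoch x (p\<^sup>2) n * qpoch (x * p) (p\<^sup>2) n" for n
    by (induction n) (simp_all add: qpoch_Suc mult_ac flip: power_mult)
  then show "(\<lambda>n. qpoch x p (2 * n)) \<longlonglongrightarrow> qpoch_inf x (p\<^sup>2) * qpoch_inf (x * p) (p\<^sup>2)"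
    using tendsto_mult[OF qpoch_LIMSEQ[OF p2, of x] qpoch_LIMSEQ[OF p2, of "x * p"]] by simp
  show "(\<lambda>n. qpoch x p (2 * n)) \<longlonglongrightarrow> qpoch_inf x p"
    by (rule LIMSEQ_subseq_LIMSEQ[OF qpoch_LIMSEQ[OF assms], unfolded o_def]) (simp add: strict_mono_def)
qed

section \<open>Reflection, recurrence and size of the inner sums\<close>

context nome
begin

text \<open>In \<open>S (- d)\<close> with d >= 0 the terms with l < d vanish; shifting l by d
  interchanges the two factors \<open>R\<close> and releases q^(2d).\<close>

lemma S_minus: "S (- d) = q powi (2 * d) * S d"
proof -
  have nonneg: "S (- int e) = q powi (2 * int e) * S (int e)" for e
  proof -
    define t where "t = (\<lambda>l::nat. q powi (2 * int l) * R (int l) * R (int l + int e))"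
    have eq: "q powi (2 * int e) * t (l - e) = q powi (2 * int l) * R (int l) * R (int l + - int e)" if "l \<ge> e" for l
    proof -
      from that obtain m where m: "l = m + e" using le_Suc_ex by (metis add.commute)
      show ?thesis unfolding m t_def by (simp add: powi_mult' mult.assoc) (simp add: algebra_simps)
    qed
    have "((\<lambda>l. q powi (2 * int e) * t l) has_sum q powi (2 * int e) * S (int e)) UNIV"
      unfolding t_def by (rule has_sum_cmult_right[OF S_has_sum])
    then have "((\<lambda>l. q powi (2 * int l) * R (int l) * R (int l + - int e)) has_sum q powi (2 * int e) * S (int e)) {e..}"
      by (subst has_sum_reindex_bij_witness[where i = "\<lambda>m. m + e" and j = "\<lambda>l. l - e" and T = UNIV
            and h = "\<lambda>l. q powi (2 * int e) * t l" and s' = "q powi (2 * int e) * S (int e)"])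
         (auto simp: eq)
    then have "((\<lambda>l. q powi (2 * int l) * R (int l) * R (int l + - int e)) has_sum q powi (2 * int e) * S (int e)) UNIV"
      by (rule has_sum_cong_neutral[THEN iffD1, rotated -1]) auto
    then show ?thesis using S_has_sum has_sum_unique by blast
  qed
  show ?thesis
  proof (cases "d \<ge> 0")
    case True
    then show ?thesis using nonneg[of "nat d"] by simp
  next
    case False
    then have "S d = q powi (- 2 * d) * S (- d)" using nonneg[of "nat (- d)"] by simp
    then show ?thesis by (simp add: powi_mult')
  qed
qed

text \<open>After reflection of the second sum the combined summand telescopes: two uses of
  \<open>R_rec\<close> make it u(l) - u(l-1) with u(l) = R(l) R(l+d). Here u(-1) = 0, and u tends to
  1/J^2.\<close>

lemma S_rec: "S (d - 1) + S (- d) = 1 / J\<^sup>2"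
proof -
  define u where "u = (\<lambda>l. R l * R (l + d))"
  define v where "v = (\<lambda>l::nat. q powi (2 * int l) * R (int l) * R (int l + (d - 1)) +
     q powi (2 * d) * (q powi (2 * int l) * R (int l) * R (int l + d)))"
  have "(v has_sum S (d - 1) + q powi (2 * d) * S d) UNIV"
    unfolding v_def by (intro has_sum_add has_sum_cmult_right S_has_sum)
  then have 1: "(\<lambda>n. \<Sum>l<n. v l) \<longlonglongrightarrow> S (d - 1) + q powi (2 * d) * S d"
    using has_sum_imp_sums unfolding sums_def by blast
  have step: "v l = u (int l) - u (int l - 1)" for l
  proof -
    have r: "R (int l + (d - 1)) = R (int l + d) * (1 - q powi (2 * int l) * q powi (2 * d))"
      using R_rec[of "int l + d"] by (simp add: powi_mult algebra_simps)
    have i: "int l - 1 + d = int l + (d - 1)" by simp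
    show ?thesis
      unfolding u_def v_def i r R_rec[of "int l"] by (simp add: algebra_simps)
  qed
  have "(\<Sum>l<n. v l) = u (int n - 1)" for n
    by (induction n) (simp_all add: step, simp add: u_def)
  moreover have "(\<lambda>n. u (int n - 1)) \<longlonglongrightarrow> 1 / J * (1 / J)"
    unfolding u_def using tendsto_mult[OF R_LIMSEQ[of "-1"] R_LIMSEQ[of "d - 1"]]
    by (simp add: algebra_simps)
  ultimately have "S (d - 1) + q powi (2 * d) * S d = 1 / J * (1 / J)"
    using 1 LIMSEQ_unique by simp
  then show ?thesis by (simp add: S_minus power2_eq_square)
qed

text \<open>A bound for fixed q, whose size as |q| tends to 1 is left open. It serves convergence
  and removes the remainder in \<open>norm_S_le\<close>.\<close>

lemma S_bounded: obtains B where "\<And>d. norm (S d) \<le> B"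
proof -
  obtain K where K: "\<And>n. norm (R n) \<le> K" "K > 0" using R_bounded by blast
  have "norm (S d) \<le> (\<Sum>\<^sub>\<infinity>l::nat. K * K * (norm q ^ 2) ^ l)" for d
    by (rule norm_infsum_le[OF S_has_sum has_sum_infsum])
       (intro summable_on_cmult_right summable_norm_q2, rule S_summand_bound[OF K])
  then show ?thesis using that by blast
qed

text \<open>
  A bound that grows only polynomially as \<open>norm q \<longlonglongrightarrow> 1\<close>, although \<open>S d\<close> itself is a sum of
  exponentially large terms: it comes from iterating \<open>S_rec\<close>.
\<close>
lemma norm_S_le: "norm (J\<^sup>2 * S d) \<le> 1 / (1 - norm q ^ 2)"
proof -
  define \<rho> where "\<rho> = norm q ^ 2"
  have \<rho>: "0 \<le> \<rho>" "\<rho> < 1" using q2_less_1 by (auto simp: \<rho>_def norm_power)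
  obtain B where B: "\<And>d. norm (S d) \<le> B" using S_bounded by blast
  have step: "norm (J\<^sup>2 * S d) \<le> 1 + \<rho> * norm (J\<^sup>2 * S (d + 1))" if "d \<ge> 0" for d
  proof -
    have "S d + q powi (2 * (d + 1)) * S (d + 1) = 1 / J\<^sup>2"
      using S_rec[of "d + 1"] unfolding S_minus by simp
    then have "S d = 1 / J\<^sup>2 - q powi (2 * (d + 1)) * S (d + 1)" by (simp add: algebra_simps)
    then have "J\<^sup>2 * S d = 1 - q powi (2 * (d + 1)) * (J\<^sup>2 * S (d + 1))"
      using J_nonzero by (simp only: right_diff_distrib mult_ac) simp
    then have "norm (J\<^sup>2 * S d) \<le> 1 + norm (q powi (2 * (d + 1)) * (J\<^sup>2 * S (d + 1)))"
      by (metis norm_one norm_triangle_ineq4)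
    also have "\<dots> \<le> 1 + \<rho> * norm (J\<^sup>2 * S (d + 1))"
    proof -
      define m where "m = nat d"
      have "2 * (d + 1) = int (2 * (m + 1))" using that by (simp add: m_def)
      then have "norm (q powi (2 * (d + 1))) = \<rho> ^ (m + 1)"
        by (simp only: norm_power_int power_int_of_nat power_mult norm_power \<rho>_def)
      also have "\<dots> \<le> \<rho> ^ 1" using \<rho> by (intro power_decreasing) auto
      finally show ?thesis unfolding norm_mult[of "q powi _"] by (intro add_left_mono mult_right_mono) auto
    qed
    finally show ?thesis .
  qed
  \<comment> \<open>1/(1-\<rho>) is the fixed point of x -> 1 + \<rho>x, so iterating
    \<open>step\<close> only shrinks the remainder, which starts from the crude bound
    \<open>B\<close>.\<close>
  have "norm (J\<^sup>2 * S d) \<le> 1 / (1 - \<rho>) + \<rho> ^ n * (norm (J\<^sup>2) * B)" if "d \<ge> 0" for d n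
    using that
  proof (induction n arbitrary: d)
    case 0
    have "norm (J\<^sup>2 * S d) \<le> norm (J\<^sup>2) * B" unfolding norm_mult by (intro mult_left_mono B) auto
    then show ?case using \<rho> by (simp add: add_increasing)
  next
    case (Suc n)
    have "norm (J\<^sup>2 * S d) \<le> 1 + \<rho> * norm (J\<^sup>2 * S (d + 1))" using step Suc.prems .
    also have "\<dots> \<le> 1 + \<rho> * (1 / (1 - \<rho>) + \<rho> ^ n * (norm (J\<^sup>2) * B))"
      using Suc.prems by (intro add_left_mono mult_left_mono Suc.IH \<rho>) auto
    also have "\<dots> = 1 / (1 - \<rho>) + \<rho> ^ Suc n * (norm (J\<^sup>2) * B)"
      using \<rho> by (simp add: field_simps)
    finally show ?case .
  qed
  moreover have "(\<lambda>n. 1 / (1 - \<rho>) + \<rho> ^ n * (norm (J\<^sup>2) * B)) \<longlonglongrightarrow> 1 / (1 - \<rho>) + 0 * (norm (J\<^sup>2) * B)"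
    by (intro tendsto_intros LIMSEQ_power_zero) (use \<rho> in auto)
  ultimately have nonneg: "norm (J\<^sup>2 * S d) \<le> 1 / (1 - \<rho>)" if "d \<ge> 0" for d
    using that LIMSEQ_le_const[of _ "1 / (1 - \<rho>)" "norm (J\<^sup>2 * S d)"] by simp
  show ?thesis
  proof (cases "d \<ge> 0")
    case True
    then show ?thesis using nonneg \<rho>_def by simp
  next
    case False
    have "S d = q powi (2 * (- d)) * S (- d)" using S_minus[of "- d"] by simp
    then have "norm (J\<^sup>2 * S d) = norm q powi (2 * (- d)) * norm (J\<^sup>2 * S (- d))"
      by (simp add: norm_mult norm_power_int)
    also have "\<dots> \<le> 1 * norm (J\<^sup>2 * S (- d))"
      using False q_less_1 by (intro mult_right_mono power_int_le_one) auto
    finally show ?thesis using nonneg[of "- d"] False \<rho>_def by simp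
  qed
qed

text \<open>The free linear and constant terms of the exponent let one lemma serve the theta series
  as well as \<open>U\<close> and \<open>V\<close>.\<close>

lemma abs_summable_gauss:
  assumes "\<And>e. norm (s e) \<le> B"
  shows "(\<lambda>e::int. norm (q powi (2 * (e * (e + 1)) + c * e + c') * s e)) summable_on UNIV"
proof -
  define r where "r = norm q ^ 2"
  have r: "0 < r" "r < 1" using q2_less_1 q_nonzero by (auto simp: r_def norm_power)
  have "(\<lambda>e::int. (B * norm q powi c') * (r powi (e * (e + 1)) * (norm q powi c) powi e)) summable_on UNIV"
    using q_pos by (intro summable_on_cmult_right summable_on_gauss r) auto
  then show ?thesis
  proof (rule Infinite_Sum.abs_summable_on_comparison_test')
    fix e
    have "r powi (e * (e + 1)) = norm q powi (2 * (e * (e + 1)))"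
      using power_int_power[of "norm q" 2 "e * (e + 1)"] by (simp add: r_def)
    moreover have "(norm q powi c) powi e = norm q powi (c * e)" by (simp add: power_int_mult)
    ultimately have "norm (q powi (2 * (e * (e + 1)) + c * e + c')) =
        norm q powi c' * (r powi (e * (e + 1)) * (norm q powi c) powi e)"
      using q_nonzero by (simp add: norm_power_int power_int_add norm_mult)
    moreover have "norm q powi c' * (r powi (e * (e + 1)) * (norm q powi c) powi e) * norm (s e) \<le>
       norm q powi c' * (r powi (e * (e + 1)) * (norm q powi c) powi e) * B"
      using r by (intro mult_left_mono assms) auto
    ultimately show "norm (q powi (2 * (e * (e + 1)) + c * e + c') * s e) \<le>
        (B * norm q powi c') * (r powi (e * (e + 1)) * (norm q powi c) powi e)"
      by (simp add: norm_mult mult_ac)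
  qed
qed

section \<open>The two theta functions and their coefficients\<close>

abbreviation \<phi> :: complex where "\<phi> \<equiv> jtheta (- (q ^ 2)) (q ^ 4)"
abbreviation \<psi> :: complex where "\<psi> \<equiv> jtheta (- 1) (q ^ 4)"

lemma nome_q2: "nome (q\<^sup>2)"
  using q2_less_1 q_nonzero by unfold_locales auto

lemma q2_powi: "(q\<^sup>2) powi n = q powi (2 * n)"
  using power_int_power[of q 2 n] by simp

lemma has_sum_int_uminus:
  fixes f :: "int \<Rightarrow> complex"
  shows "((\<lambda>n. f (- n)) has_sum a) UNIV \<longleftrightarrow> (f has_sum a) UNIV"
  by (rule has_sum_reindex_bij_witness[where i = uminus and j = uminus]) auto

lemma phi_has_sum: "((\<lambda>n. q powi (2 * n * n)) has_sum \<phi>) UNIV"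
proof -
  have "((\<lambda>n. (q\<^sup>2) powi (n * (n - 1)) * (- (- (q ^ 2))) powi n) has_sum jtheta (- (q ^ 2)) ((q\<^sup>2)\<^sup>2)) UNIV"
    by (rule nome.jacobi_triple_product[OF nome_q2]) (use q_nonzero in auto)
  moreover have "(q\<^sup>2) powi (n * (n - 1)) * (- (- (q ^ 2))) powi n = q powi (2 * n * n)" for n
    by (simp add: q2_powi powi_mult) (simp add: algebra_simps)
  ultimately show ?thesis by simp
qed

lemma psi_has_sum: "((\<lambda>n. q powi (2 * n * (n + 1))) has_sum \<psi>) UNIV"
proof -
  have "((\<lambda>n. (q\<^sup>2) powi (n * (n - 1)) * (- (- 1)) powi n) has_sum jtheta (- 1) ((q\<^sup>2)\<^sup>2)) UNIV"
    by (rule nome.jacobi_triple_product[OF nome_q2]) auto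
  then have "((\<lambda>n. q powi (2 * n * (n - 1))) has_sum \<psi>) UNIV"
    by (simp add: q2_powi mult.assoc)
  then show ?thesis
    by (subst (asm) has_sum_int_uminus[symmetric]) (simp add: algebra_simps)
qed

lemma abs_summable_phi: "(\<lambda>n. norm (q powi (2 * n * n))) summable_on UNIV"
  using abs_summable_gauss[of "\<lambda>_. 1" 1 "-2" 0] by (simp add: algebra_simps)

lemma abs_summable_psi: "(\<lambda>n. norm (q powi (2 * n * (n + 1)))) summable_on UNIV"
  using abs_summable_gauss[of "\<lambda>_. 1" 1 0 0] by (simp add: algebra_simps)

text \<open>\<open>U\<close> collects the even and \<open>V\<close> the odd differences b - a at x =
  q^j. An integer parameter j covers both evaluation points x = 1 and x = q.\<close>

definition U :: "int \<Rightarrow> complex" where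
  "U j = (\<Sum>\<^sub>\<infinity>e. q powi (2 * e * e + 2 * j * e) * S (2 * e))"

definition V :: "int \<Rightarrow> complex" where
  "V j = (\<Sum>\<^sub>\<infinity>e. q powi (2 * e * e - 2 * e + j * (2 * e - 1)) * S (2 * e - 1))"

lemma U_abs_summable: "(\<lambda>e. norm (q powi (2 * e * e + 2 * j * e) * S (2 * e))) summable_on UNIV"
proof -
  obtain B where B: "\<And>d. norm (S d) \<le> B" using S_bounded by blast
  show ?thesis
    using abs_summable_gauss[of "\<lambda>e. S (2 * e)" B "2 * j - 2" 0] B by (simp add: algebra_simps)
qed

lemma V_abs_summable:
  "(\<lambda>e. norm (q powi (2 * e * e - 2 * e + j * (2 * e - 1)) * S (2 * e - 1))) summable_on UNIV"
proof -
  obtain B where B: "\<And>d. norm (S d) \<le> B" using S_bounded by blast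
  show ?thesis
    using abs_summable_gauss[of "\<lambda>e. S (2 * e - 1)" B "2 * j - 4" "- j"] B by (simp add: algebra_simps)
qed

lemma U_has_sum: "((\<lambda>e. q powi (2 * e * e + 2 * j * e) * S (2 * e)) has_sum U j) UNIV"
  unfolding U_def using has_sum_infsum[OF Infinite_Sum.abs_summable_summable[OF U_abs_summable]] .

lemma V_has_sum: "((\<lambda>e. q powi (2 * e * e - 2 * e + j * (2 * e - 1)) * S (2 * e - 1)) has_sum V j) UNIV"
  unfolding V_def using has_sum_infsum[OF Infinite_Sum.abs_summable_summable[OF V_abs_summable]] .

text \<open>With a = m - e the Gaussian exponent is 2e^2 + 2m(m+1) for b = m + e and 2e^2 - 2e +
  2m^2 for b = m + e - 1. Thus m sums to \<psi> or \<phi>, while e sums to \<open>U\<close> or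
  \<open>V\<close>; the minus sign is that of an odd power of -x.\<close>

lemma bilateral_regrouped:
  "((\<lambda>n. q powi (2 * n * (n + 1)) * qpoch_inf (q powi j * q powi (2 * n + 2)) (q\<^sup>2) *
      qpoch_inf (q powi (2 * n + 4) / q powi j) (q\<^sup>2)) has_sum \<psi> * U j - \<phi> * V j) UNIV"
proof -
  have x: "q powi j \<noteq> 0" using q_nonzero by simp
  define f where "f = (\<lambda>a b. (- (q powi j)) powi (b - a) * q powi (a * (a + 1) + b * (b + 1)) * S (b - a))"
  obtain G where G: "((\<lambda>(a, b). f a b) has_sum G) UNIV"
    "((\<lambda>n. q powi (2 * n * (n + 1)) * qpoch_inf (q powi j * q powi (2 * n + 2)) (q\<^sup>2) *
      qpoch_inf (q powi (2 * n + 4) / q powi j) (q\<^sup>2)) has_sum G) UNIV"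
    using bilateral_expansion[OF x] unfolding f_def by blast
  have sgn: "(- (q powi j)) powi n = (if even n then 1 else - 1) * q powi (j * n)" for n
    by (simp add: power_int_minus_left power_int_mult)
  have "((\<lambda>(e, m). f (m - e) (m + e)) has_sum U j * \<psi>) (UNIV \<times> UNIV)"
  proof -
    have "f (m - e) (m + e) = (q powi (2 * e * e + 2 * j * e) * S (2 * e)) * q powi (2 * m * (m + 1))" for e m
    proof -
      have "(m + e) - (m - e) = 2 * e" by simp
      then show ?thesis
        unfolding f_def sgn by (simp add: powi_mult' powi_mult mult_ac) (simp add: algebra_simps)
    qed
    then show ?thesis
      using has_sum_product(1)[OF U_abs_summable abs_summable_psi U_has_sum psi_has_sum] by (simp only:)
  qed
  moreover have "((\<lambda>(e, m). f (m - e) (m + e - 1)) has_sum - (V j * \<phi>)) (UNIV \<times> UNIV)"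
  proof -
    have "f (m - e) (m + e - 1) =
        - ((q powi (2 * e * e - 2 * e + j * (2 * e - 1)) * S (2 * e - 1)) * q powi (2 * m * m))" for e m
    proof -
      have "(m + e - 1) - (m - e) = 2 * e - 1" by simp
      then show ?thesis
        unfolding f_def sgn by (simp add: powi_mult' powi_mult mult_ac) (simp add: algebra_simps)
    qed
    moreover have "((\<lambda>z. - (case z of (e, m) \<Rightarrow> (q powi (2 * e * e - 2 * e + j * (2 * e - 1)) * S (2 * e - 1)) * q powi (2 * m * m)))
       has_sum - (V j * \<phi>)) (UNIV \<times> UNIV)"
      by (intro has_sum_uminusI has_sum_product(1)[OF V_abs_summable abs_summable_phi V_has_sum phi_has_sum])
    ultimately show ?thesis by (simp only: case_prod_unfold)
  qed
  ultimately have "((\<lambda>(a, b). f a b) has_sum U j * \<psi> + - (V j * \<phi>)) UNIV"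
    by (intro has_sum_int_parity) simp_all
  then have "G = \<psi> * U j - \<phi> * V j" using G(1) has_sum_unique by fastforce
  then show ?thesis using G(2) by simp
qed

text \<open>Reflecting e replaces \<open>S (2 * e)\<close> by \<open>S (- (2 * e))\<close>, which
  \<open>S_rec\<close> pairs with the term \<open>S (2 * e - 1)\<close> of \<open>q * V 1\<close>.
  Each pair has the constant sum 1/J^2, leaving the series of \<phi>.\<close>

lemma U_0: "U 0 = \<phi> / J\<^sup>2 - q * V 1"
proof -
  have "((\<lambda>e. q powi (2 * e * e) * S (2 * e)) has_sum U 0) UNIV" using U_has_sum[of 0] by simp
  then have "((\<lambda>e. q powi (2 * e * e) * S (- (2 * e))) has_sum U 0) UNIV"
    by (subst (asm) has_sum_int_uminus[symmetric]) simp
  moreover have "((\<lambda>e. q * (q powi (2 * e * e - 2 * e + 1 * (2 * e - 1)) * S (2 * e - 1))) has_sum q * V 1) UNIV"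
    by (rule has_sum_cmult_right[OF V_has_sum])
  moreover have "q * (q powi (2 * e * e - 2 * e + 1 * (2 * e - 1)) * S (2 * e - 1)) = q powi (2 * e * e) * S (2 * e - 1)" for e
    using powi_mult'[of 1 "2 * e * e - 2 * e + 1 * (2 * e - 1)"] by simp
  ultimately have "((\<lambda>e. q powi (2 * e * e) * S (- (2 * e)) + q powi (2 * e * e) * S (2 * e - 1)) has_sum U 0 + q * V 1) UNIV"
    by (intro has_sum_add) (simp_all only:)
  moreover have "q powi (2 * e * e) * S (- (2 * e)) + q powi (2 * e * e) * S (2 * e - 1) = q powi (2 * e * e) * (1 / J\<^sup>2)" for e
    using S_rec[of "2 * e"] by (metis add.commute distrib_left)
  ultimately have "((\<lambda>e. q powi (2 * e * e) * (1 / J\<^sup>2)) has_sum U 0 + q * V 1) UNIV" by (simp only:)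
  moreover have "((\<lambda>e. q powi (2 * e * e) * (1 / J\<^sup>2)) has_sum \<phi> * (1 / J\<^sup>2)) UNIV"
    by (rule has_sum_cmult_left[OF phi_has_sum])
  ultimately have "U 0 + q * V 1 = \<phi> * (1 / J\<^sup>2)" by (rule has_sum_unique)
  then show ?thesis by (simp add: algebra_simps)
qed

text \<open>The same pairing, now of the reflected \<open>V 0\<close> with \<open>U 1\<close>; the
  remaining Gaussian is that of \<psi>.\<close>

lemma V_0: "V 0 = \<psi> / J\<^sup>2 - U 1"
proof -
  have "((\<lambda>e. q powi (2 * e * e - 2 * e) * S (2 * e - 1)) has_sum V 0) UNIV" using V_has_sum[of 0] by simp
  then have "((\<lambda>e. q powi (2 * e * (e + 1)) * S (- (2 * e + 1))) has_sum V 0) UNIV"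
  proof (subst (asm) has_sum_int_uminus[symmetric])
    have "2 * - e * - e - 2 * - e = 2 * e * (e + 1)" "2 * - e - 1 = - (2 * e + 1)" for e :: int
      by (simp_all add: algebra_simps)
    then show "((\<lambda>e. q powi (2 * - e * - e - 2 * - e) * S (2 * - e - 1)) has_sum V 0) UNIV \<Longrightarrow> ?thesis"
      by (simp only:)
  qed
  moreover have "((\<lambda>e. q powi (2 * e * (e + 1)) * S (2 * e + 1 - 1)) has_sum U 1) UNIV"
    using U_has_sum[of 1] by (simp add: algebra_simps)
  ultimately have "((\<lambda>e. q powi (2 * e * (e + 1)) * S (- (2 * e + 1)) + q powi (2 * e * (e + 1)) * S (2 * e + 1 - 1)) has_sum V 0 + U 1) UNIV"
    by (rule has_sum_add)
  moreover have "q powi (2 * e * (e + 1)) * S (- (2 * e + 1)) + q powi (2 * e * (e + 1)) * S (2 * e + 1 - 1) =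
      q powi (2 * e * (e + 1)) * (1 / J\<^sup>2)" for e
    using S_rec[of "2 * e + 1"] by (metis add.commute distrib_left)
  ultimately have "((\<lambda>e. q powi (2 * e * (e + 1)) * (1 / J\<^sup>2)) has_sum V 0 + U 1) UNIV" by (simp only:)
  moreover have "((\<lambda>e. q powi (2 * e * (e + 1)) * (1 / J\<^sup>2)) has_sum \<psi> * (1 / J\<^sup>2)) UNIV"
    by (rule has_sum_cmult_left[OF psi_has_sum])
  ultimately have "V 0 + U 1 = \<psi> * (1 / J\<^sup>2)" by (rule has_sum_unique)
  then show ?thesis by (simp add: algebra_simps)
qed


section \<open>The bilateral series at \<open>x = 1\<close> and at \<open>x = q\<close>\<close>

lemma qpoch_inf_powi_zero:
  assumes "m \<le> 0"
  shows "qpoch_inf (q powi (2 * m)) (q\<^sup>2) = 0"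
proof -
  obtain k where m: "m = - int k" using assms by (metis nat_0_le neg_0_le_iff_le minus_minus)
  have "q powi (2 * m) * (q\<^sup>2) ^ k = q powi (2 * m) * q powi (2 * int k)"
    using q2_powi[of "int k"] by simp
  also have "\<dots> = 1" by (simp add: powi_mult m)
  finally have "qpoch (q powi (2 * m)) (q\<^sup>2) (Suc k) = 0" by (simp add: qpoch_Suc)
  then show ?thesis using qpoch_inf_split[OF q2_less_1, of "q powi (2 * m)" "Suc k"] by simp
qed

lemma qpoch_inf_powi:
  "qpoch_inf (q powi (2 * int n + 2)) (q\<^sup>2) = J * R (int n)"
proof -
  have "q powi (2 * int n + 2) = q\<^sup>2 * (q\<^sup>2) ^ n"
    using q_nonzero q2_powi[of "int n"] by (simp add: power_int_add)
  then show ?thesis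
    using qpoch_inf_split[OF q2_less_1, of "q\<^sup>2" n] qpoch_nonzero[OF q2_less_1 q2_less_1, of n]
    by (simp add: R_of_nat)
qed

text \<open>For n < 0 the product starting at q^(2n+2) contains the factor 1 - q^0 = 0. The
  remaining terms are J^2 times the Durfee terms for d = 1.\<close>

lemma bilateral_at_1: "\<psi> * U 0 - \<phi> * V 0 = J"
proof -
  define t where "t = (\<lambda>n. q powi (2 * n * (n + 1)) * qpoch_inf (q powi (2 * n + 2)) (q\<^sup>2) *
      qpoch_inf (q powi (2 * n + 4)) (q\<^sup>2))"
  have "(t has_sum \<psi> * U 0 - \<phi> * V 0) UNIV"
    unfolding t_def using bilateral_regrouped[of 0] by simp
  moreover have "(t has_sum J) UNIV"
  proof -
    have "((\<lambda>n. J\<^sup>2 * durfee_term 1 n) has_sum J\<^sup>2 * (1 / J)) UNIV"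
      using norm_summable_imp_has_sum[OF summable_durfee_term summable_sums[OF summable_durfee_term']]
      unfolding durfee_rectangle by (rule has_sum_cmult_right)
    moreover have "t (int n) = J\<^sup>2 * durfee_term 1 n" for n
    proof -
      have e: "2 * int n * (int n + 1) = int (2 * (n * n + n * 1))" by (simp add: algebra_simps)
      have i: "2 * int n + 4 = 2 * int (Suc n) + 2" by simp
      show ?thesis unfolding t_def i qpoch_inf_powi unfolding e power_int_of_nat durfee_term_def
        by (simp add: power2_eq_square mult_ac add.commute)
    qed
    ultimately have "((\<lambda>n. t (int n)) has_sum J) UNIV" using J_nonzero by (simp add: power2_eq_square)
    moreover have "t (- 1 - int n) = 0" for n
      using qpoch_inf_powi_zero[of "- int n"] unfolding t_def by (simp add: algebra_simps)
    then have "((\<lambda>n. t (- 1 - int n)) has_sum 0) UNIV" by simp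
    ultimately show ?thesis using has_sum_int_split by fastforce
  qed
  ultimately show ?thesis by (rule has_sum_unique)
qed

abbreviation P :: complex where "P \<equiv> qpoch_inf q (q\<^sup>2)"

lemma P_nonzero: "P \<noteq> 0"
  by (rule qpoch_inf_nonzero_norm[OF q2_less_1 q_less_1])

lemma qpoch_inf_odd_pos: "qpoch_inf (q powi (2 * int n + 3)) (q\<^sup>2) = P / qpoch q (q\<^sup>2) (n + 1)"
proof -
  have "2 * int n + 3 = int (2 * n + 3)" by simp
  then have "q powi (2 * int n + 3) = q ^ (2 * n + 3)" by (simp only: power_int_of_nat)
  also have "2 * n + 3 = Suc (2 * (n + 1))" by simp
  also have "q ^ Suc (2 * (n + 1)) = q * (q\<^sup>2) ^ (n + 1)" by (simp only: power_Suc power_mult)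
  finally show ?thesis
    using qpoch_inf_split[OF q2_less_1, of q "n + 1"] qpoch_nonzero[OF q2_less_1 q_less_1, of "n + 1"]
    by (simp add: field_simps)
qed

text \<open>The m factors with negative exponent are reflected by 1 - 1/y = -(1-y)/y. They become
  those of (q;q^2)_m, and the extracted powers of q add up to -m^2.\<close>

lemma qpoch_inf_odd_neg:
  "qpoch_inf (q powi (1 - 2 * int m)) (q\<^sup>2) = (- 1) ^ m * q powi (- (int m * int m)) * qpoch q (q\<^sup>2) m * P"
proof (induction m)
  case (Suc m)
  let ?x = "q powi (1 - 2 * int (Suc m))"
  have x: "?x * q\<^sup>2 = q powi (1 - 2 * int m)"
    using powi_mult[of "1 - 2 * int (Suc m)" 2] by simp
  have "qpoch_inf ?x (q\<^sup>2) = (1 - ?x) * qpoch_inf (q powi (1 - 2 * int m)) (q\<^sup>2)"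
    using qpoch_inf_split[OF q2_less_1, of ?x 1] x by (simp add: qpoch_def)
  also have "1 - ?x = - ?x * (1 - q * (q\<^sup>2) ^ m)"
  proof -
    have "?x * (q * (q\<^sup>2) ^ m) = q powi (1 - 2 * int (Suc m)) * q powi (1 + 2 * int m)"
      using q2_powi[of "int m"] powi_mult[of 1 "2 * int m"] by simp
    also have "\<dots> = 1" by (simp add: powi_mult)
    finally show ?thesis by (simp add: algebra_simps)
  qed
  finally have "qpoch_inf ?x (q\<^sup>2) = (- 1) ^ Suc m * (?x * q powi (- (int m * int m))) *
      (qpoch q (q\<^sup>2) m * (1 - q * (q\<^sup>2) ^ m)) * P"
    unfolding Suc by simp
  also have "?x * q powi (- (int m * int m)) = q powi (- (int (Suc m) * int (Suc m)))"
    by (simp add: powi_mult) (simp add: algebra_simps)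
  finally show ?case by (simp only: qpoch_Suc)
qed simp

text \<open>At x = q the two products in each term coincide, hence the squares. For n = -1-m the
  Gaussian factor is q^(2m(m+1)), while the squared reflection contributes q^(-2m^2), so only q^(2m)
  survives.\<close>

lemma bilateral_at_q:
  shows "summable (\<lambda>m. qpoch q (q\<^sup>2) m ^ 2 * q ^ (2 * m))"
    and "\<psi> * U 1 - \<phi> * V 1 = P\<^sup>2 * (mock_w q + (\<Sum>m. qpoch q (q\<^sup>2) m ^ 2 * q ^ (2 * m)))"
proof -
  define t where "t = (\<lambda>n. q powi (2 * n * (n + 1)) * qpoch_inf (q powi (2 * n + 3)) (q\<^sup>2) ^ 2)"
  define w where "w = (\<lambda>n. q ^ (2 * n * (n + 1)) / (qpoch q (q\<^sup>2) (n + 1)) ^ 2)"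
  define v where "v = (\<lambda>m. qpoch q (q\<^sup>2) m ^ 2 * q ^ (2 * m))"
  have t: "(t has_sum \<psi> * U 1 - \<phi> * V 1) UNIV"
  proof -
    have "q powi 1 * q powi (2 * n + 2) = q powi (2 * n + 3)" for n
    proof -
      have "1 + (2 * n + 2) = 2 * n + 3" by simp
      then show ?thesis by (simp only: powi_mult)
    qed
    moreover have "q powi (2 * n + 4) / q powi 1 = q powi (2 * n + 3)" for n
    proof -
      have "2 * n + 3 + 1 = 2 * n + 4" by simp
      then have "q powi (2 * n + 4) = q powi (2 * n + 3) * q powi 1" by (simp only: powi_mult)
      then show ?thesis using q_nonzero by simp
    qed
    ultimately show ?thesis unfolding t_def using bilateral_regrouped[of 1]
      by (simp only: power2_eq_square mult.assoc)
  qed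
  have pos: "t (int n) = P\<^sup>2 * w n" for n
  proof -
    have e: "2 * int n * (int n + 1) = int (2 * n * (n + 1))" by (simp add: algebra_simps)
    show ?thesis unfolding t_def w_def qpoch_inf_odd_pos unfolding e power_int_of_nat by (simp add: power_divide)
  qed
  have neg: "t (- 1 - int m) = P\<^sup>2 * v m" for m
  proof -
    have e: "2 * (- 1 - int m) + 3 = 1 - 2 * int m" "2 * (- 1 - int m) * (- 1 - int m + 1) = 2 * (int m * int m) + int (2 * m)"
      by (simp_all add: algebra_simps)
    have s: "((- 1) ^ m * q powi (- (int m * int m)) * qpoch q (q\<^sup>2) m * P)\<^sup>2 =
        q powi (- (2 * (int m * int m))) * (qpoch q (q\<^sup>2) m ^ 2 * P\<^sup>2)"
    proof -
      have "(((- 1) ^ m)\<^sup>2 :: complex) = 1" by (cases "even m") auto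
      moreover have "(q powi (- (int m * int m)))\<^sup>2 = q powi (- (2 * (int m * int m)))"
        by (simp add: power2_eq_square powi_mult)
      ultimately show ?thesis unfolding power_mult_distrib by simp
    qed
    have "q powi (2 * (int m * int m) + int (2 * m)) * (q powi (- (2 * (int m * int m))) * (qpoch q (q\<^sup>2) m ^ 2 * P\<^sup>2)) =
       q powi (int (2 * m)) * (qpoch q (q\<^sup>2) m ^ 2 * P\<^sup>2)"
      by (simp only: powi_mult') simp
    then show ?thesis unfolding t_def e qpoch_inf_odd_neg s v_def power_int_of_nat by (simp only: mult_ac)
  qed
  have summ: "t summable_on A" for A
    using t has_sum_imp_summable summable_on_subset by blast
  have "(t has_sum infsum t {0..}) {0..}" "(t has_sum infsum t {..<0}) {..<0}"
    by (intro has_sum_infsum summ)+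
  then have hw: "((\<lambda>n. P\<^sup>2 * w n) has_sum infsum t {0..}) UNIV"
    and hv: "((\<lambda>n. P\<^sup>2 * v n) has_sum infsum t {..<0}) UNIV"
    unfolding has_sum_int_nonneg has_sum_int_neg pos neg by simp_all
  have "(w has_sum infsum t {0..} / P\<^sup>2) UNIV" "(v has_sum infsum t {..<0} / P\<^sup>2) UNIV"
    using hw hv P_nonzero by (simp_all add: has_sum_cmult_right_iff)
  then have sw: "w sums (infsum t {0..} / P\<^sup>2)" and sv: "v sums (infsum t {..<0} / P\<^sup>2)"
    by (simp_all add: has_sum_imp_sums)
  show "summable (\<lambda>m. qpoch q (q\<^sup>2) m ^ 2 * q ^ (2 * m))"
    using sv unfolding v_def by (rule sums_summable)
  have "mock_w q = infsum t {0..} / P\<^sup>2"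
    using sw unfolding w_def mock_w_def by (rule sums_unique[symmetric])
  moreover have "(\<Sum>m. v m) = infsum t {..<0} / P\<^sup>2" using sv by (rule sums_unique[symmetric])
  moreover have "infsum t {0..} + infsum t {..<0} = \<psi> * U 1 - \<phi> * V 1"
  proof -
    have "(t has_sum infsum t {0..} + infsum t {..<0}) UNIV"
      using hw hv unfolding pos[symmetric] neg[symmetric] by (rule has_sum_int_split)
    then show ?thesis using t by (rule has_sum_unique)
  qed
  ultimately show "\<psi> * U 1 - \<phi> * V 1 = P\<^sup>2 * (mock_w q + (\<Sum>m. qpoch q (q\<^sup>2) m ^ 2 * q ^ (2 * m)))"
    using P_nonzero unfolding v_def by (simp add: distrib_left)
qed

section \<open>Theta identities and the product form of \<open>theta_w\<close>\<close>

lemma jtheta_q: "jtheta q (q\<^sup>2) = P\<^sup>2 * J"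
proof -
  have "q\<^sup>2 / q = q" using q_nonzero by (simp add: power2_eq_square)
  then show ?thesis by (simp add: jtheta_def power2_eq_square)
qed

text \<open>In classical notation, \<theta>_4(q)^2 = \<theta>_3(q^2)^2 - \<theta>_2(q^2)^2. The
  series of (-1)^n q^(n^2) is squared and split by the parity of a + b, which also fixes the sign
  (-1)^(a+b).\<close>

lemma phi_psi_relation: "\<phi>\<^sup>2 - q * \<psi>\<^sup>2 = (P\<^sup>2 * J)\<^sup>2"
proof -
  define g where "g = (\<lambda>n::int. (- 1) powi n * q powi (n * n))"
  define f where "f = (\<lambda>a b. g a * g b)"
  have g: "(g has_sum P\<^sup>2 * J) UNIV"
  proof -
    have "((\<lambda>n. q powi (n * (n - 1)) * (- q) powi n) has_sum jtheta q (q\<^sup>2)) UNIV"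
      by (rule jacobi_triple_product[OF q_nonzero])
    moreover have "q powi (n * (n - 1)) * (- q) powi n = g n" for n
    proof -
      have "(- q) powi n = (- 1) powi n * q powi n"
        using power_int_mult_distrib[of "- 1" q n] by simp
      then show ?thesis unfolding g_def by (simp add: powi_mult' powi_mult mult_ac) (simp add: algebra_simps)
    qed
    ultimately show ?thesis by (simp add: jtheta_q)
  qed
  have gn: "(\<lambda>n. norm (g n)) summable_on UNIV"
  proof -
    have "(\<lambda>n. norm q powi (n * (n + 1)) * inverse (norm q) powi n) summable_on UNIV"
      using q_pos q_less_1 by (intro summable_on_gauss) auto
    moreover have "norm q powi (n * (n + 1)) * inverse (norm q) powi n = norm (g n)" for n
    proof -
      have "n * (n + 1) = n * n + n" by (simp add: algebra_simps)
      then show ?thesis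
        using q_nonzero by (simp add: g_def norm_mult norm_power_int power_int_add power_int_inverse)
    qed
    ultimately show ?thesis by simp
  qed
  have "((\<lambda>(a, b). f a b) has_sum (P\<^sup>2 * J) * (P\<^sup>2 * J)) (UNIV \<times> UNIV)"
    unfolding f_def by (rule has_sum_product(1)[OF gn gn g g])
  moreover have "((\<lambda>(a, b). f a b) has_sum \<phi> * \<phi> + - (q * (\<psi> * \<psi>))) UNIV"
  proof (rule has_sum_int_parity)
    have "f (m - e) (m + e) = q powi (2 * e * e) * q powi (2 * m * m)" for e m
    proof -
      have "(- 1 :: complex) powi (m - e) * (- 1) powi (m + e) = 1"
        by (simp add: power_int_minus_left)
      then show ?thesis unfolding f_def g_def
        by (simp add: mult_ac powi_mult' powi_mult) (simp add: algebra_simps)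
    qed
    then show "((\<lambda>(e, m). f (m - e) (m + e)) has_sum \<phi> * \<phi>) UNIV"
      using has_sum_product(1)[OF abs_summable_phi abs_summable_phi phi_has_sum phi_has_sum] by simp
  next
    have psi': "((\<lambda>n. q powi (2 * n * (n - 1))) has_sum \<psi>) UNIV"
      using psi_has_sum by (subst (asm) has_sum_int_uminus[symmetric]) (simp add: algebra_simps)
    have npsi': "(\<lambda>n. norm (q powi (2 * n * (n - 1)))) summable_on UNIV"
      using abs_summable_gauss[of "\<lambda>_. 1" 1 "-4" 0] by (simp add: algebra_simps)
    have "f (m - e) (m + e - 1) = - (q * (q powi (2 * e * (e - 1)) * q powi (2 * m * (m - 1))))" for e m
    proof -
      have "(- 1 :: complex) powi (m - e) * (- 1) powi (m + e - 1) = - 1"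
        by (simp add: power_int_minus_left)
      then have "f (m - e) (m + e - 1) = - (q powi ((m - e) * (m - e)) * q powi ((m + e - 1) * (m + e - 1)))"
      proof -
        have "f (m - e) (m + e - 1) = ((- 1) powi (m - e) * (- 1) powi (m + e - 1)) *
            (q powi ((m - e) * (m - e)) * q powi ((m + e - 1) * (m + e - 1)))"
          unfolding f_def g_def by (simp only: mult_ac)
        then show ?thesis using \<open>_ = - 1\<close> by simp
      qed
      also have "\<dots> = - (q powi 1 * (q powi (2 * e * (e - 1)) * q powi (2 * m * (m - 1))))"
        unfolding powi_mult by (simp add: algebra_simps del: power_int_1_right)
      finally show ?thesis by simp
    qed
    moreover have "((\<lambda>z. - (q * (case z of (e, m) \<Rightarrow> q powi (2 * e * (e - 1)) * q powi (2 * m * (m - 1))))) has_sum - (q * (\<psi> * \<psi>))) (UNIV \<times> UNIV)"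
      by (intro has_sum_uminusI has_sum_cmult_right has_sum_product(1)[OF npsi' npsi' psi' psi'])
    ultimately show "((\<lambda>(e, m). f (m - e) (m + e - 1)) has_sum - (q * (\<psi> * \<psi>))) UNIV"
      by (simp add: case_prod_unfold)
  qed
  ultimately have "(P\<^sup>2 * J) * (P\<^sup>2 * J) = \<phi> * \<phi> + - (q * (\<psi> * \<psi>))"
    using has_sum_unique by fastforce
  then show ?thesis by (simp add: power2_eq_square)
qed

lemma psi_nonzero: "\<psi> \<noteq> 0"
proof -
  have q4: "norm (q ^ 4) < 1" using q_less_1 by (simp add: norm_power power_less_one_iff)
  have "- 1 * (q ^ 4) ^ i \<noteq> 1" for i
  proof (cases i)
    case (Suc k)
    have "norm (- 1 * (q ^ 4) ^ i) < 1"
      using q4 q_nonzero Suc power_Suc_less_one[of "norm (q ^ 4)" k] by (simp add: norm_power norm_mult)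
    then show ?thesis by (metis less_irrefl norm_one)
  qed auto
  then have "qpoch_inf (- 1) (q ^ 4) \<noteq> 0" using qpoch_inf_nonzero[OF q4] by blast
  moreover have "qpoch_inf (q ^ 4 / - 1) (q ^ 4) \<noteq> 0" "qpoch_inf (q ^ 4) (q ^ 4) \<noteq> 0"
    using qpoch_inf_nonzero_norm q4 by auto
  ultimately show ?thesis by (simp add: jtheta_def)
qed

text \<open>\<open>J_bar 1 4 q\<close> equals J/P: its two products of base q^4 merge into
  (-q;q^2)_\<infinity>, and multiplication by P = (q;q^2)_\<infinity> gives
  (q^2;q^4)_\<infinity>.\<close>

lemma theta_w_eq: "theta_w q = \<phi> * J / (\<psi> * P\<^sup>2)"
proof -
  have q4: "norm (q ^ 4) < 1" using q_less_1 by (simp add: norm_power power_less_one_iff)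
  have "qpoch_inf (- q) (q\<^sup>2) = qpoch_inf (- q) (q ^ 4) * qpoch_inf (- q * q\<^sup>2) (q ^ 4)"
    using qpoch_inf_even_odd[OF q2_less_1, of "- q"] by simp
  moreover have "q ^ 4 / (- q) = - q * q\<^sup>2"
    using q_nonzero by (simp add: field_simps eval_nat_numeral)
  ultimately have 1: "J_bar 1 4 q = qpoch_inf (- q) (q\<^sup>2) * qpoch_inf (q ^ 4) (q ^ 4)"
    by (simp add: J_bar_def jtheta_def)
  have "P * qpoch_inf (- q) (q\<^sup>2) = qpoch_inf (q\<^sup>2) (q ^ 4)"
    using qpoch_inf_mult_minus[OF q2_less_1, of q] by simp
  moreover have "J = qpoch_inf (q\<^sup>2) (q ^ 4) * qpoch_inf (q ^ 4) (q ^ 4)"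
    using qpoch_inf_even_odd[OF q2_less_1, of "q\<^sup>2"] by (simp flip: power_add)
  ultimately have "P * J_bar 1 4 q = J" using 1 by (simp add: mult_ac)
  then have "J_bar 1 4 q = J / P" using P_nonzero by (simp add: field_simps)
  moreover have "J_bar 2 4 q = \<phi>" "J_bar 0 4 q = \<psi>" "J_single 2 q = J"
    by (simp_all add: J_bar_def J_single_def)
  ultimately show ?thesis
    using J_nonzero unfolding theta_w_def by (simp add: power2_eq_square mult_ac)
qed

text \<open>\<open>V 1\<close> is eliminated between the two evaluations of the bilateral series.\<close>
theorem mock_w_minus_theta_w:
  "q * mock_w q - theta_w q =
     - q * (\<Sum>m. qpoch q (q\<^sup>2) m ^ 2 * q ^ (2 * m)) - P\<^sup>2 / \<psi> * (J\<^sup>2 * U 1)"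
proof -
  define T where "T = (\<Sum>m. qpoch q (q\<^sup>2) m ^ 2 * q ^ (2 * m))"
  have 1: "\<psi> * U 1 - \<phi> * V 1 = P\<^sup>2 * (mock_w q + T)"
    using bilateral_at_q(2) by (simp add: T_def)
  have 2: "\<phi> * U 1 - q * (\<psi> * V 1) = J"
    using bilateral_at_1 unfolding U_0 V_0 by (simp add: algebra_simps)
  have "q * \<psi> * (P\<^sup>2 * (mock_w q + T)) = q * \<psi> * (\<psi> * U 1 - \<phi> * V 1)" by (simp only: 1)
  \<comment> \<open>Adding and subtracting \<open>\<phi>^2 * U 1\<close> exposes the left-hand side
    of equation 2 and the determinant of the system.\<close>
  also have "\<dots> = \<phi> * (\<phi> * U 1 - q * (\<psi> * V 1)) - (\<phi>\<^sup>2 - q * \<psi>\<^sup>2) * U 1"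
    by (simp add: algebra_simps power2_eq_square)
  also have "\<dots> = \<phi> * J - (P\<^sup>2 * J)\<^sup>2 * U 1" by (simp only: 2 phi_psi_relation)
  finally have "q * (mock_w q + T) = (\<phi> * J - (P\<^sup>2 * J)\<^sup>2 * U 1) / (\<psi> * P\<^sup>2)"
    using psi_nonzero P_nonzero by (simp add: field_simps)
  also have "\<dots> = \<phi> * J / (\<psi> * P\<^sup>2) - P\<^sup>2 / \<psi> * (J\<^sup>2 * U 1)"
    using psi_nonzero P_nonzero by (simp add: diff_divide_distrib power2_eq_square)
  finally show ?thesis unfolding theta_w_eq T_def[symmetric] by (simp add: algebra_simps)
qed

text \<open>The exponent 2e(e+1) is at least e for e >= 0 and at least -1-e for e < 0. Two geometric
  series dominate, each multiplied by the uniform bound of \<open>norm_S_le\<close>.\<close>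

lemma norm_U_1_le: "norm (J\<^sup>2 * U 1) \<le> 2 / ((1 - norm q) * (1 - norm q ^ 2))"
proof -
  define r where "r = norm q"
  have r: "0 < r" "r < 1" using q_pos q_less_1 by (auto simp: r_def)
  have r2: "r\<^sup>2 < 1" using q2_less_1 by (simp add: r_def norm_power)
  define f where "f = (\<lambda>e. norm (J\<^sup>2 * (q powi (2 * e * e + 2 * 1 * e) * S (2 * e))))"
  have bound: "f e \<le> 1 / (1 - r\<^sup>2) * r ^ n" if "2 * e * e + 2 * e \<ge> int n" for e n
  proof -
    have "f e = norm q powi (2 * e * e + 2 * 1 * e) * norm (J\<^sup>2 * S (2 * e))"
      unfolding f_def by (simp add: norm_mult norm_power_int)
    also have "\<dots> \<le> r ^ n * (1 / (1 - r\<^sup>2))"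
    proof (intro mult_mono)
      have "r powi (2 * e * e + 2 * e) \<le> r powi (int n)"
        using that r by (intro power_int_decreasing) auto
      then show "norm q powi (2 * e * e + 2 * 1 * e) \<le> r ^ n" by (simp add: r_def)
    qed (use r norm_S_le in \<open>auto simp: r_def\<close>)
    finally show ?thesis by (simp add: mult.commute)
  qed
  have geo: "((\<lambda>n. 1 / (1 - r\<^sup>2) * r ^ n) has_sum 1 / (1 - r\<^sup>2) * (1 / (1 - r))) UNIV"
    using r geometric_sums[of r] by (intro has_sum_cmult_right norm_summable_imp_has_sum) auto
  have g: "((\<lambda>e. if e \<ge> 0 then 1 / (1 - r\<^sup>2) * r ^ nat e else 1 / (1 - r\<^sup>2) * r ^ nat (- 1 - e)) has_sum
      1 / (1 - r\<^sup>2) * (1 / (1 - r)) + 1 / (1 - r\<^sup>2) * (1 / (1 - r))) UNIV"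
    by (rule has_sum_int_split) (use geo in simp_all)
  have h: "((\<lambda>e. J\<^sup>2 * (q powi (2 * e * e + 2 * 1 * e) * S (2 * e))) has_sum J\<^sup>2 * U 1) UNIV"
    by (rule has_sum_cmult_right[OF U_has_sum])
  have "f e \<le> (if e \<ge> 0 then 1 / (1 - r\<^sup>2) * r ^ nat e else 1 / (1 - r\<^sup>2) * r ^ nat (- 1 - e))" for e
  proof (cases "e \<ge> 0")
    case True
    then have "2 * e * e + 2 * e \<ge> int (nat e)" by (simp add: add_increasing)
    from bound[OF this] show ?thesis using True by simp
  next
    case False
    define m where "m = nat (- 1 - e)"
    have e: "e = - 1 - int m" using False by (simp add: m_def)
    have "2 * e * e + 2 * e \<ge> int m" unfolding e by (simp add: algebra_simps)
    from bound[OF this] show ?thesis using False e by simp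
  qed
  then have "norm (J\<^sup>2 * U 1) \<le> 1 / (1 - r\<^sup>2) * (1 / (1 - r)) + 1 / (1 - r\<^sup>2) * (1 / (1 - r))"
    unfolding f_def by (rule norm_infsum_le[OF h g])
  also have "\<dots> = 2 / ((1 - r) * (1 - r\<^sup>2))"
    by (simp only: mult_2[symmetric]) (simp add: mult.commute)
  finally show ?thesis by (simp add: r_def)
qed

end

section \<open>Behaviour near roots of unity of odd order\<close>

lemma eventually_at_left_1: "eventually (\<lambda>r::real. 0 < r \<and> r < 1) (at_left 1)"
  using eventually_at_left_real[of 0 "1::real"] by simp

lemma diff_power_le:
  fixes r :: real
  assumes "0 \<le> r" "r \<le> 1"
  shows "1 - r ^ n \<le> real n * (1 - r)"
  using Bernoulli_inequality[of "r - 1" n] assms by (simp add: algebra_simps)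

lemma diff_power_ge:
  fixes r :: real
  assumes "0 \<le> r" "r \<le> 1"
  shows "real m * r ^ m * (1 - r) \<le> 1 - r ^ m"
proof -
  have "real m * r ^ m = (\<Sum>i<m. r ^ m)" by simp
  also have "\<dots> \<le> (\<Sum>i<m. r ^ i)"
    by (intro sum_mono power_decreasing) (use assms in auto)
  finally have "(1 - r) * (real m * r ^ m) \<le> (1 - r) * (\<Sum>i<m. r ^ i)"
    by (intro mult_left_mono) (use assms in auto)
  then show ?thesis by (simp only: one_diff_power_eq[symmetric] mult_ac)
qed

lemma primitive_root_power_eq_1_iff:
  assumes "primitive_root_of_unity N z"
  shows "z ^ n = 1 \<longleftrightarrow> N dvd n"
proof
  have N: "N > 0" "z ^ N = 1" "\<And>m. 0 < m \<Longrightarrow> m < N \<Longrightarrow> z ^ m \<noteq> 1"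
    using assms by (auto simp: primitive_root_of_unity_def)
  show "N dvd n \<Longrightarrow> z ^ n = 1" using N by (auto simp: power_mult elim!: dvdE)
  assume "z ^ n = 1"
  have "z ^ n = z ^ (n div N * N + n mod N)" by simp
  also have "\<dots> = (z ^ N) ^ (n div N) * z ^ (n mod N)"
    by (simp only: power_add power_mult mult.commute[of "n div N" N])
  finally have "z ^ (n mod N) = 1" using \<open>z ^ n = 1\<close> N by simp
  then have "\<not> 0 < n mod N" using N(3)[of "n mod N"] N(1) by auto
  then show "N dvd n" by (simp add: mod_eq_0_iff_dvd)
qed

lemma primitive_root_norm:
  assumes "primitive_root_of_unity N z"
  shows "norm z = 1"
proof -
  have "norm z ^ N = 1" "N > 0"
    using assms by (auto simp: primitive_root_of_unity_def simp flip: norm_power)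
  then show ?thesis using power_eq_imp_eq_base[of "norm z" N 1] by auto
qed

text \<open>The factor 1-r extracts the residue: there is a simple pole at r = 1 exactly when w =
  1.\<close>

lemma tendsto_one_minus_over:
  fixes w :: complex
  assumes "j > 0"
  shows "((\<lambda>r::real. of_real (1 - r) / (1 - of_real r ^ j * w)) \<longlongrightarrow> (if w = 1 then 1 / of_nat j else 0)) (at_left 1)"
proof (cases "w = 1")
  case True
  have "((\<lambda>r::real. 1 / (\<Sum>i<j. complex_of_real r ^ i)) \<longlongrightarrow> 1 / (\<Sum>i<j. complex_of_real 1 ^ i)) (at_left 1)"
    by (intro tendsto_intros) (use assms in auto)
  moreover have "eventually (\<lambda>r::real. 1 / (\<Sum>i<j. complex_of_real r ^ i) = of_real (1 - r) / (1 - of_real r ^ j * w)) (at_left 1)"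
    using eventually_at_left_1
  proof eventually_elim
    case (elim r)
    then have "complex_of_real (1 - r) \<noteq> 0" by auto
    then show ?case using True one_diff_power_eq[of "complex_of_real r" j] by simp
  qed
  ultimately show ?thesis using True by (auto elim: Lim_transform_eventually)
next
  case False
  have "((\<lambda>r::real. of_real (1 - r) / (1 - of_real r ^ j * w)) \<longlongrightarrow> of_real (1 - 1) / (1 - of_real 1 ^ j * w)) (at_left 1)"
    by (intro tendsto_intros) (use False in auto)
  then show ?thesis using False by simp
qed

lemma exp_inverse_decay:
  fixes c :: real
  assumes "c > 0"
  shows "((\<lambda>r. exp (- c / (1 - r)) / (1 - r)\<^sup>2) \<longlongrightarrow> 0) (at_left 1)"
proof (rule tendsto_sandwich[OF _ _ tendsto_const])
  have "((\<lambda>r::real. 27 / c ^ 3 * (1 - r)) \<longlongrightarrow> 27 / c ^ 3 * (1 - 1)) (at_left 1)"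
    by (intro tendsto_intros)
  then show "((\<lambda>r::real. 27 / c ^ 3 * (1 - r)) \<longlongrightarrow> 0) (at_left 1)" by simp
  show "eventually (\<lambda>r. 0 \<le> exp (- c / (1 - r)) / (1 - r)\<^sup>2) (at_left 1)" by simp
  show "eventually (\<lambda>r. exp (- c / (1 - r)) / (1 - r)\<^sup>2 \<le> 27 / c ^ 3 * (1 - r)) (at_left 1)"
    using eventually_at_left_1
  proof eventually_elim
    case (elim r)
    define x where "x = c / (1 - r)"
    have x: "x > 0" using elim assms by (simp add: x_def)
    \<comment> \<open>Cubing this gives exp x >= x^3/27. The third power is enough to absorb (1-r)^2
      and leave one factor 1-r.\<close>
    have "x / 3 \<le> exp (x / 3)" using exp_ge_add_one_self[of "x / 3"] by linarith
    then have "(x / 3) ^ 3 \<le> exp (x / 3) ^ 3" using x by (intro power_mono) auto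
    also have "\<dots> = exp x" by (simp flip: exp_of_nat_mult)
    finally have "x ^ 3 / 27 \<le> exp x" by (simp add: power_divide)
    then have "exp (- x) \<le> 27 / x ^ 3" using x by (simp add: exp_minus field_simps)
    then have "exp (- x) / (1 - r)\<^sup>2 \<le> 27 / x ^ 3 / (1 - r)\<^sup>2"
      using elim by (intro divide_right_mono) auto
    also have "\<dots> = 27 / c ^ 3 * (1 - r)"
    proof -
      define s where "s = 1 - r"
      have "s > 0" using elim by (simp add: s_def)
      then show ?thesis
        using assms unfolding x_def s_def[symmetric] by (simp add: field_simps power2_eq_square power3_eq_cube)
    qed
    finally show ?case by (simp add: x_def)
  qed
qed

section \<open>Exponential decay of the factor of the correction\<close>

context nome
begin

lemma theta_factor_eq_exp:
  "P\<^sup>2 / \<psi> = exp (\<Sum>n. (- 2 * (q ^ Suc n / (1 - q ^ (2 * Suc n))) +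
     (2 * (- 1) ^ Suc n + 1) * (q ^ (4 * Suc n) / (1 - q ^ (4 * Suc n)))) / of_nat (Suc n)) / 2"
proof -
  have q4: "norm (q ^ 4) < 1" using q_less_1 by (simp add: norm_power power_less_one_iff)
  define A where "A = qpoch_inf (- (q ^ 4)) (q ^ 4)"
  define B where "B = qpoch_inf (q ^ 4) (q ^ 4)"
  define a where "a = (\<lambda>n. q ^ Suc n / (of_nat (Suc n) * (1 - (q\<^sup>2) ^ Suc n)))"
  define b where "b = (\<lambda>n. (- (q ^ 4)) ^ Suc n / (of_nat (Suc n) * (1 - (q ^ 4) ^ Suc n)))"
  define c where "c = (\<lambda>n. (q ^ 4) ^ Suc n / (of_nat (Suc n) * (1 - (q ^ 4) ^ Suc n)))"
  have P: "P = exp (- suminf a)" and sa: "summable a"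
    unfolding a_def by (rule qpoch_inf_eq_exp summable_qpoch_log; use q2_less_1 q_less_1 in simp)+
  have A: "A = exp (- suminf b)" and sb: "summable b"
    unfolding A_def b_def by (rule qpoch_inf_eq_exp summable_qpoch_log; use q4 in simp)+
  have B: "B = exp (- suminf c)" and sc: "summable c"
    unfolding B_def c_def by (rule qpoch_inf_eq_exp summable_qpoch_log; use q4 in simp)+
  \<comment> \<open>The logarithmic expansion requires an argument of norm below 1, which -1 is not.
    Its first factor 1 - (-1) = 2 is split off, and this is the source of the final division by
    2.\<close>
  have "qpoch_inf (- 1) (q ^ 4) = 2 * A"
    using qpoch_inf_split[OF q4, of "- 1" 1] by (simp add: A_def qpoch_def)
  then have psi: "\<psi> = 2 * A\<^sup>2 * B"
    by (simp add: jtheta_def A_def B_def power2_eq_square)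
  have "P\<^sup>2 / \<psi> = exp (- 2 * suminf a) / (2 * (exp (- 2 * suminf b) * exp (- suminf c)))"
    unfolding psi unfolding P A B by (simp flip: exp_double)
  also have "\<dots> = exp (- 2 * suminf a + (2 * suminf b + suminf c)) / 2"
    by (simp add: exp_add exp_minus exp_diff field_simps)
  also have "- 2 * suminf a + (2 * suminf b + suminf c) = (\<Sum>n. - 2 * a n + (2 * b n + c n))"
    by (simp only: suminf_mult[symmetric] suminf_add[symmetric] sa sb sc summable_mult summable_add)
  also have "(\<lambda>n. - 2 * a n + (2 * b n + c n)) = (\<lambda>n. (- 2 * (q ^ Suc n / (1 - q ^ (2 * Suc n))) +
     (2 * (- 1) ^ Suc n + 1) * (q ^ (4 * Suc n) / (1 - q ^ (4 * Suc n)))) / of_nat (Suc n))"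
  proof
    fix n
    have "(- (q ^ 4)) ^ Suc n = (- 1) ^ Suc n * (q ^ 4) ^ Suc n" by (rule power_minus)
    then show "- 2 * a n + (2 * b n + c n) = (- 2 * (q ^ Suc n / (1 - q ^ (2 * Suc n))) +
     (2 * (- 1) ^ Suc n + 1) * (q ^ (4 * Suc n) / (1 - q ^ (4 * Suc n)))) / of_nat (Suc n)"
      unfolding a_def b_def c_def power_mult
      by (simp add: add_divide_distrib diff_divide_distrib ring_distribs mult.commute[of "of_nat (Suc n)"]
        del: power_Suc of_nat_Suc)
  qed
  finally show ?thesis .
qed

end

text \<open>A bound uniform in r even at the poles: |1 - q^j| >= 1 - r^m >= m r^m (1-r), and r^m
  cancels against the numerator. The further factor 1/m of the logarithmic series then gives a
  majorant of order 1/m^2.\<close>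

lemma norm_log_summand_le:
  fixes q :: complex
  assumes r: "0 < r" "r < 1" and q: "norm q = r" and "0 < m" "m \<le> i" "m \<le> j"
  shows "(1 - r) * norm (q ^ i / (1 - q ^ j)) \<le> 1 / real m"
proof -
  have "r ^ m < 1" using assms by (simp add: power_less_one_iff)
  have "1 - r ^ m \<le> 1 - r ^ j" using assms by (simp add: power_decreasing)
  also have "\<dots> \<le> norm (1 - q ^ j)"
    using norm_triangle_ineq2[of 1 "q ^ j"] q by (simp add: norm_power)
  finally have d: "1 - r ^ m \<le> norm (1 - q ^ j)" .
  have "(1 - r) * norm (q ^ i / (1 - q ^ j)) = (1 - r) * r ^ i / norm (1 - q ^ j)"
    by (simp add: norm_divide norm_power q)
  also have "\<dots> \<le> (1 - r) * r ^ m / (1 - r ^ m)"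
    using assms \<open>r ^ m < 1\<close> by (intro frac_le mult_left_mono power_decreasing d) auto
  also have "\<dots> \<le> 1 / real m"
    using diff_power_ge[of r m] assms \<open>r ^ m < 1\<close> by (simp add: field_simps)
  finally show ?thesis .
qed

text \<open>Multiplied by 1-r, the logarithm converges termwise to the sum of the residues
  \<open>g\<close>. Tannery's theorem permits the interchange, and all that matters is that the
  limit is negative.\<close>

lemma theta_factor_exponential_decay:
  assumes \<zeta>: "primitive_root_of_unity N \<zeta>" and "odd N"
  obtains c where "c > 0" "eventually (\<lambda>r::real. norm ((qpoch_inf (of_real r * \<zeta>) ((of_real r * \<zeta>)\<^sup>2))\<^sup>2 /
     jtheta (- 1) ((of_real r * \<zeta>) ^ 4)) \<le> exp (- c / (1 - r))) (at_left 1)"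
proof -
  have N: "N > 0" using \<zeta> by (simp add: primitive_root_of_unity_def)
  have norm: "norm \<zeta> = 1" using primitive_root_norm[OF \<zeta>] .
  define a where "a = (\<lambda>n (r::real). of_real (1 - r) * ((- 2 * ((of_real r * \<zeta>) ^ Suc n / (1 - (of_real r * \<zeta>) ^ (2 * Suc n))) +
     (2 * (- 1) ^ Suc n + 1) * ((of_real r * \<zeta>) ^ (4 * Suc n) / (1 - (of_real r * \<zeta>) ^ (4 * Suc n)))) / of_nat (Suc n)))"
  \<comment> \<open>For m = Suc n divisible by N, the scaled fractions with denominators 1 - q^(2m)
    and 1 - q^(4m) tend to 1/(2m) and 1/(4m). The numerator -1 + (2(-1)^m + 1)/4 is -5/4 for odd m
    and -1/4 for even m.\<close>
  define g where "g = (\<lambda>n. if N dvd Suc n then (- 1 + (2 * (- 1) ^ Suc n + 1) / 4) / real (Suc n) ^ 2 else 0)"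
  have lim: "((\<lambda>r. a n r) \<longlongrightarrow> of_real (g n)) (at_left 1)" for n
  proof -
    define m where "m = Suc n"
    have m: "m > 0" by (simp add: m_def)
    have z: "\<zeta> ^ (2 * m) = 1 \<longleftrightarrow> N dvd m" "\<zeta> ^ (4 * m) = 1 \<longleftrightarrow> N dvd m" "\<zeta> ^ m = 1 \<longleftrightarrow> N dvd m"
    proof -
      have "coprime N 2" using \<open>odd N\<close> by simp
      then have "coprime N 4" using coprime_power_right_iff[of N 2 2] by simp
      then show "\<zeta> ^ (2 * m) = 1 \<longleftrightarrow> N dvd m" "\<zeta> ^ (4 * m) = 1 \<longleftrightarrow> N dvd m" "\<zeta> ^ m = 1 \<longleftrightarrow> N dvd m"
        using \<open>coprime N 2\<close> by (simp_all add: primitive_root_power_eq_1_iff[OF \<zeta>] coprime_dvd_mult_right_iff)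
    qed
    have eq: "a n r = (- 2 * ((of_real r * \<zeta>) ^ m * (of_real (1 - r) / (1 - of_real r ^ (2 * m) * \<zeta> ^ (2 * m)))) +
       (2 * (- 1) ^ m + 1) * ((of_real r * \<zeta>) ^ (4 * m) * (of_real (1 - r) / (1 - of_real r ^ (4 * m) * \<zeta> ^ (4 * m))))) / of_nat m" for r
      unfolding a_def m_def[symmetric] power_mult_distrib[of _ \<zeta>]
      by (simp add: add_divide_distrib diff_divide_distrib ring_distribs mult_ac)
    have "((\<lambda>r. a n r) \<longlongrightarrow> (- 2 * ((of_real 1 * \<zeta>) ^ m * (if \<zeta> ^ (2 * m) = 1 then 1 / of_nat (2 * m) else 0)) +
       (2 * (- 1) ^ m + 1) * ((of_real 1 * \<zeta>) ^ (4 * m) * (if \<zeta> ^ (4 * m) = 1 then 1 / of_nat (4 * m) else 0))) / of_nat m) (at_left 1)"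
      unfolding eq by (intro tendsto_intros tendsto_one_minus_over) (use m in auto)
    also have "(- 2 * ((of_real 1 * \<zeta>) ^ m * (if \<zeta> ^ (2 * m) = 1 then 1 / of_nat (2 * m) else 0)) +
       (2 * (- 1) ^ m + 1) * ((of_real 1 * \<zeta>) ^ (4 * m) * (if \<zeta> ^ (4 * m) = 1 then 1 / of_nat (4 * m) else 0))) / of_nat m =
       complex_of_real (g n)"
    proof (cases "N dvd m")
      case True
      then have "\<zeta> ^ m = 1" "\<zeta> ^ (2 * m) = 1" "\<zeta> ^ (4 * m) = 1" using z by simp_all
      then show ?thesis using True m
        by (simp add: g_def m_def[symmetric] add_divide_distrib power2_eq_square ring_distribs del: of_nat_mult) (simp add: field_simps)
    next
      case False
      then have "\<not> N dvd Suc n" by (simp add: m_def)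
      then show ?thesis using z False by (simp add: g_def)
    qed
    finally show ?thesis .
  qed
  have bound: "norm (a n r) \<le> 5 / real (Suc n) ^ 2" if r: "0 < r" "r < 1" for n r
  proof -
    define q where "q = of_real r * \<zeta>"
    have q: "norm q = r" using norm r by (simp add: q_def norm_mult)
    let ?X = "q ^ Suc n / (1 - q ^ (2 * Suc n))" and ?Y = "q ^ (4 * Suc n) / (1 - q ^ (4 * Suc n))"
    have X: "(1 - r) * norm ?X \<le> 1 / real (Suc n)"
      by (rule norm_log_summand_le[OF r q]) auto
    have Y: "(1 - r) * norm ?Y \<le> 1 / real (Suc n)"
      by (rule norm_log_summand_le[OF r q]) auto
    have "norm (2 * (- 1) ^ Suc n + 1 :: complex) \<le> norm (2 * (- 1) ^ Suc n :: complex) + norm (1 :: complex)"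
      by (rule norm_triangle_ineq)
    then have 3: "norm (2 * (- 1) ^ Suc n + 1 :: complex) \<le> 3" by (simp add: norm_mult norm_power)
    have "norm (- 2 * ?X + (2 * (- 1) ^ Suc n + 1) * ?Y) \<le> 2 * norm ?X + norm (2 * (- 1) ^ Suc n + 1 :: complex) * norm ?Y"
      by (rule order_trans[OF norm_triangle_ineq]) (simp only: norm_mult norm_minus_cancel norm_numeral order_refl)
    also have "\<dots> \<le> 2 * norm ?X + 3 * norm ?Y"
      using 3 by (intro add_left_mono mult_right_mono) auto
    finally have "(1 - r) * norm (- 2 * ?X + (2 * (- 1) ^ Suc n + 1) * ?Y) \<le> (1 - r) * (2 * norm ?X + 3 * norm ?Y)"
      using r by (intro mult_left_mono) auto
    also have "\<dots> \<le> 5 / real (Suc n)" using X Y by (simp add: algebra_simps)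
    finally have *: "(1 - r) * norm (- 2 * ?X + (2 * (- 1) ^ Suc n + 1) * ?Y) \<le> 5 / real (Suc n)" .
    have "norm (a n r) = (1 - r) * norm (- 2 * ?X + (2 * (- 1) ^ Suc n + 1) * ?Y) / real (Suc n)"
      unfolding a_def q_def[symmetric] norm_mult[of "of_real (1 - r)"] norm_divide[of _ "of_nat (Suc n)"] norm_of_real norm_of_nat
      using r by simp
    also have "\<dots> \<le> 5 / real (Suc n) / real (Suc n)" by (intro divide_right_mono *) auto
    finally show ?thesis by (simp add: power2_eq_square del: of_nat_Suc)
  qed
  have sM: "summable (\<lambda>n. 5 / real (Suc n) ^ 2)"
    using summable_mult[OF sums_summable[OF inverse_squares_sums], of 5] by (simp add: add.commute)
  have "eventually (\<lambda>(n, r). norm (a n r) \<le> 5 / real (Suc n) ^ 2) (at_top \<times>\<^sub>F at_left (1::real))"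
    using eventually_prodI[OF always_eventually[of "\<lambda>_. True" "at_top :: nat filter"] eventually_at_left_1]
    by (rule eventually_mono) (use bound in auto)
  from tannerys_theorem[OF lim this sM]
  have tan: "summable (\<lambda>n. norm (complex_of_real (g n)))"
    "((\<lambda>r. \<Sum>n. a n r) \<longlongrightarrow> (\<Sum>n. complex_of_real (g n))) (at_left 1)"
    by auto
  have sg: "summable g" using tan(1) summable_norm_cancel[of g] by simp
  have g_le: "g n \<le> 0" for n
    by (cases "even n") (auto simp: g_def divide_nonpos_pos)
  \<comment> \<open>The index N - 1 stands for m = N, the first multiple of N. All terms are at most
    0, and this one is -5/(4N^2) because N is odd.\<close>
  have "suminf g \<le> sum g {N - 1}"
  proof -
    have "sum (\<lambda>n. - g n) {N - 1} \<le> (\<Sum>n. - g n)"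
      using sg g_le by (intro sum_le_suminf summable_minus) auto
    then show ?thesis using suminf_minus[OF sg] by simp
  qed
  also have "sum g {N - 1} < 0"
  proof -
    have "Suc (N - 1) = N" using N by simp
    then have "g (N - 1) = (- 1 + (2 * (- 1) ^ N + 1) / 4) / real N ^ 2" by (simp add: g_def del: power_Suc)
    also have "\<dots> < 0" using N \<open>odd N\<close> by simp
    finally show ?thesis by simp
  qed
  finally have neg: "suminf g < 0" .
  \<comment> \<open>Half of the limit, so that the strict inequality holds eventually.\<close>
  define c where "c = - suminf g / 2"
  have c: "c > 0" using neg by (simp add: c_def)
  have "((\<lambda>r. Re (\<Sum>n. a n r)) \<longlongrightarrow> Re (\<Sum>n. complex_of_real (g n))) (at_left 1)"
    by (intro tendsto_intros tan)
  moreover have "Re (\<Sum>n. complex_of_real (g n)) = suminf g"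
    using suminf_of_real[OF sg, where ?'a = complex] by (metis Re_complex_of_real)
  ultimately have "eventually (\<lambda>r. Re (\<Sum>n. a n r) < - c) (at_left 1)"
    using neg by (intro order_tendstoD) (auto simp: c_def)
  then have "eventually (\<lambda>r::real. norm ((qpoch_inf (of_real r * \<zeta>) ((of_real r * \<zeta>)\<^sup>2))\<^sup>2 /
     jtheta (- 1) ((of_real r * \<zeta>) ^ 4)) \<le> exp (- c / (1 - r))) (at_left 1)"
    using eventually_at_left_1
  proof eventually_elim
    case (elim r)
    define q where "q = of_real r * \<zeta>"
    interpret nome q
      by unfold_locales (use elim norm in \<open>auto simp: q_def norm_mult\<close>)
    define u where "u = (\<lambda>n. (- 2 * (q ^ Suc n / (1 - q ^ (2 * Suc n))) +
       (2 * (- 1) ^ Suc n + 1) * (q ^ (4 * Suc n) / (1 - q ^ (4 * Suc n)))) / of_nat (Suc n))"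
    have ua: "u n = inverse (of_real (1 - r)) * a n r" for n
    proof -
      have "a n r = of_real (1 - r) * u n" unfolding a_def u_def q_def ..
      moreover have "complex_of_real (1 - r) \<noteq> 0" using elim by (simp del: of_real_diff)
      ultimately show ?thesis by (simp del: of_real_diff)
    qed
    have "summable (\<lambda>n. a n r)"
      by (rule summable_comparison_test'[OF sM]) (use bound elim in auto)
    then have "suminf u = inverse (of_real (1 - r)) * (\<Sum>n. a n r)"
      unfolding ua by (rule suminf_mult)
    also have "inverse (complex_of_real (1 - r)) = of_real (inverse (1 - r))" by simp
    finally have "Re (suminf u) = Re (\<Sum>n. a n r) / (1 - r)"
      by (simp add: divide_inverse mult.commute del: of_real_inverse)
    also have "\<dots> \<le> - c / (1 - r)" using elim by (intro divide_right_mono) auto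
    finally have "Re (suminf u) \<le> - c / (1 - r)" .
    then have "exp (Re (suminf u)) \<le> exp (- c / (1 - r))" by simp
    moreover have "norm (P\<^sup>2 / \<psi>) = exp (Re (suminf u)) / 2"
      unfolding theta_factor_eq_exp u_def[symmetric] by (simp add: norm_divide norm_exp_eq_Re)
    moreover have "exp (Re (suminf u)) / 2 \<le> exp (Re (suminf u))" by simp
    ultimately show ?case unfolding q_def by linarith
  qed
  then show ?thesis using c that by blast
qed

text \<open>For odd N the exponents 2i+1 run through all residues modulo N. Both sides are
  polynomials in y of degree at most N that agree at 0 and at the N inverses of these powers, hence
  at N + 1 points.\<close>

lemma prod_one_minus_odd_powers:
  assumes \<zeta>: "primitive_root_of_unity N \<zeta>" and "odd N"
  shows "(\<Prod>i<N. 1 - y * \<zeta> ^ (2 * i + 1)) = 1 - y ^ N"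
proof -
  have N: "N > 0" "\<zeta> ^ N = 1" using \<zeta> by (auto simp: primitive_root_of_unity_def)
  have nz: "\<zeta> \<noteq> 0" using primitive_root_norm[OF \<zeta>] by auto
  define x where "x = (\<lambda>i. inverse (\<zeta> ^ (2 * i + 1)))"
  have neq: "\<zeta> ^ (2 * i + 1) \<noteq> \<zeta> ^ (2 * j + 1)" if "i < j" "j < N" for i j
  proof
    assume eq: "\<zeta> ^ (2 * i + 1) = \<zeta> ^ (2 * j + 1)"
    have "2 * j + 1 = (2 * i + 1) + 2 * (j - i)" using that by simp
    then have "\<zeta> ^ (2 * j + 1) = \<zeta> ^ (2 * i + 1) * \<zeta> ^ (2 * (j - i))" by (simp only: power_add)
    then have "\<zeta> ^ (2 * (j - i)) = 1" using eq nz by simp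
    then have "N dvd 2 * (j - i)" using primitive_root_power_eq_1_iff[OF \<zeta>] by blast
    moreover have "coprime N 2" using \<open>odd N\<close> by simp
    ultimately have "N dvd j - i" by (simp add: coprime_dvd_mult_right_iff)
    then show False using that by (auto dest: dvd_imp_le)
  qed
  have inj: "inj_on x {..<N}"
  proof (rule inj_onI)
    fix i j assume "i \<in> {..<N}" "j \<in> {..<N}" "x i = x j"
    then show "i = j" using neq[of i j] neq[of j i] by (cases i j rule: linorder_cases) (auto simp: x_def)
  qed
  define p where "p = (\<Prod>i<N. [:1, - (\<zeta> ^ (2 * i + 1)):])"
  define q where "q = 1 - monom (1::complex) N"
  have "p = q"
  proof (rule poly_eqI_degree)
    have card: "card (insert 0 (x ` {..<N})) = N + 1"
      using inj nz by (subst card_insert_disjoint) (auto simp: card_image x_def)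
    have "degree p \<le> (\<Sum>i<N. degree [:1, - (\<zeta> ^ (2 * i + 1)):])"
      unfolding p_def by (rule degree_prod_sum_le[unfolded o_def]) simp
    also have "\<dots> \<le> (\<Sum>i<N. 1)" by (intro sum_mono) simp
    finally show "degree p < card (insert 0 (x ` {..<N}))" unfolding card by simp
    have "degree q \<le> N" unfolding q_def by (intro degree_diff_le) (auto simp: degree_monom_le)
    then show "degree q < card (insert 0 (x ` {..<N}))" unfolding card by simp
    fix z assume "z \<in> insert 0 (x ` {..<N})"
    then consider "z = 0" | i where "i < N" "z = x i" by auto
    then show "poly p z = poly q z"
    proof cases
      case 1
      then show ?thesis using N by (simp add: p_def q_def poly_prod poly_monom)
    next
      case 2
      have "x i * \<zeta> ^ (2 * i + 1) = 1"
        unfolding x_def by (rule left_inverse) (use nz in simp)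
      then have "1 - z * \<zeta> ^ (2 * i + 1) = 0" unfolding 2(2) by (simp only: diff_self)
      then have "(\<Prod>j<N. 1 - z * \<zeta> ^ (2 * j + 1)) = 0"
        using 2 by (intro prod_zero) auto
      then have "poly p z = 0" by (simp add: p_def poly_prod)
      moreover have "z ^ N = 1"
      proof -
        have "(\<zeta> ^ (2 * i + 1)) ^ N = (\<zeta> ^ N) ^ (2 * i + 1)"
          by (metis power_mult mult.commute)
        also have "\<dots> = 1" using N by simp
        finally show ?thesis unfolding 2(2) x_def power_inverse by (simp only: inverse_1)
      qed
      ultimately show ?thesis by (simp add: q_def poly_monom)
    qed
  qed
  then have "poly p y = poly q y" by simp
  then show ?thesis by (simp add: p_def q_def poly_prod poly_monom)
qed

lemma norm_qpoch_le:
  assumes "norm x \<le> 1" "norm p \<le> 1"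
  shows "norm (qpoch x p n) \<le> 2 ^ n"
proof -
  have "norm (1 - x * p ^ i) \<le> 2" for i
  proof -
    have "norm (x * p ^ i) \<le> 1"
      unfolding norm_mult norm_power using assms by (intro mult_le_one power_le_one) auto
    then show ?thesis using norm_triangle_ineq4[of 1 "x * p ^ i"] by simp
  qed
  then have "(\<Prod>i<n. norm (1 - x * p ^ i)) \<le> (\<Prod>i<n. 2)" by (intro prod_mono) auto
  then show ?thesis by (simp add: qpoch_def flip: prod_norm)
qed

text \<open>
  Freezing the powers of \<open>r\<close> turns a block of \<open>N\<close> factors into \<open>1 - y ^ N\<close>; the error is
  proportional to \<open>y\<close>, which makes the errors of all blocks summable.
\<close>
lemma qpoch_block_approx:
  assumes \<zeta>: "primitive_root_of_unity N \<zeta>" and N: "odd N"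
    and r: "0 \<le> r" "r \<le> 1" and y: "0 \<le> y" "y \<le> 1"
  defines "q \<equiv> of_real r * \<zeta>"
  shows "norm (qpoch (of_real y * q) (q\<^sup>2) N - (1 - of_real y ^ N)) \<le> 2 ^ N * real N ^ 2 * (1 - r) * y"
proof -
  have norm: "norm \<zeta> = 1" using primitive_root_norm[OF \<zeta>] .
  \<comment> \<open>\<open>norm_prod_diff\<close> compares products of factors in the unit disk,
    whereas these factors can have norm 2. Halving them costs 2^N; it also turns the bound 2i+1 <=
    2N into N, and summing over N factors gives N^2.\<close>
  define z where "z = (\<lambda>i. (1 - of_real (y * r ^ (2 * i + 1)) * \<zeta> ^ (2 * i + 1)) / 2)"
  define w where "w = (\<lambda>i. (1 - of_real y * \<zeta> ^ (2 * i + 1)) / 2)"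
  have half: "norm ((1 - of_real t * \<zeta> ^ j) / 2) \<le> 1" if "0 \<le> t" "t \<le> 1" for t j
    using norm_triangle_ineq4[of 1 "of_real t * \<zeta> ^ j"] that norm by (simp add: norm_divide norm_mult norm_power)
  have "norm (prod z {..<N} - prod w {..<N}) \<le> (\<Sum>i<N. norm (z i - w i))"
  proof (rule norm_prod_diff)
    show "norm (z i) \<le> 1" for i
      unfolding z_def using r y by (intro half mult_nonneg_nonneg mult_le_one zero_le_power power_le_one) auto
    show "norm (w i) \<le> 1" for i unfolding w_def by (intro half y)
  qed
  also have "\<dots> \<le> (\<Sum>i<N. y * (real N * (1 - r)))"
  proof (rule sum_mono)
    fix i assume i: "i \<in> {..<N}"
    have "z i - w i = of_real (y * (1 - r ^ (2 * i + 1)) / 2) * \<zeta> ^ (2 * i + 1)"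
      unfolding z_def w_def of_real_mult of_real_diff of_real_divide of_real_1 of_real_numeral
      by (simp add: field_simps del: power_Suc)
    then have "norm (z i - w i) = \<bar>y * (1 - r ^ (2 * i + 1)) / 2\<bar> * 1"
      by (simp only: norm_mult norm_of_real norm_power norm power_one)
    also have "r ^ (2 * i + 1) \<le> 1" using r by (rule power_le_one)
    then have "\<bar>y * (1 - r ^ (2 * i + 1)) / 2\<bar> * 1 = y * ((1 - r ^ (2 * i + 1)) / 2)"
      using y by (simp del: power_Suc)
    also have "\<dots> \<le> y * (real N * (1 - r))"
    proof (rule mult_left_mono[OF _ y(1)])
      have "1 - r ^ (2 * i + 1) \<le> real (2 * i + 1) * (1 - r)" by (rule diff_power_le[OF r])
      also have "\<dots> \<le> (2 * real N) * (1 - r)" using i r by (intro mult_right_mono) auto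
      finally show "(1 - r ^ (2 * i + 1)) / 2 \<le> real N * (1 - r)" by (simp del: power_Suc)
    qed
    finally show "norm (z i - w i) \<le> y * (real N * (1 - r))" .
  qed
  also have "\<dots> = real N ^ 2 * (1 - r) * y" by (simp add: power2_eq_square)
  finally have "2 ^ N * norm (prod z {..<N} - prod w {..<N}) \<le> 2 ^ N * (real N ^ 2 * (1 - r) * y)"
    by (intro mult_left_mono) auto
  moreover have "2 ^ N * prod z {..<N} = qpoch (of_real y * q) (q\<^sup>2) N"
  proof -
    have e: "of_real y * q * (q\<^sup>2) ^ i = of_real (y * r ^ (2 * i + 1)) * \<zeta> ^ (2 * i + 1)" for i
    proof -
      have "q * (q\<^sup>2) ^ i = q ^ (2 * i + 1)" by (simp add: power_mult)
      also have "\<dots> = of_real (r ^ (2 * i + 1)) * \<zeta> ^ (2 * i + 1)"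
        unfolding q_def by (simp only: power_mult_distrib of_real_power)
      finally show ?thesis by (simp only: of_real_mult mult.assoc)
    qed
    show ?thesis
      unfolding qpoch_def z_def prod_dividef e by simp
  qed
  moreover have "2 ^ N * prod w {..<N} = 1 - of_real y ^ N"
    unfolding w_def prod_dividef using prod_one_minus_odd_powers[OF \<zeta> N, of "of_real y"] by simp
  ultimately show ?thesis
    by (metis (no_types, lifting) mult.assoc norm_mult norm_numeral norm_power right_diff_distrib)
qed

text \<open>In the first block y = 1, so 1 - y^N = 0 and only the error O(1-r) remains. A later
  block has norm at most 1 plus its error, and these errors sum to at most C0, because (1-r) times
  the sum of the powers r^(2Nt) is at most 1.\<close>

lemma qpoch_root_of_unity_bound:
  assumes \<zeta>: "primitive_root_of_unity N \<zeta>" and N: "odd N"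
  obtains C where "C > 0" "\<And>r m. 0 \<le> r \<Longrightarrow> r < 1 \<Longrightarrow> N \<le> m \<Longrightarrow>
    norm (qpoch (of_real r * \<zeta>) ((of_real r * \<zeta>)\<^sup>2) m) \<le> C * (1 - r)"
proof
  define C0 where "C0 = 2 ^ N * real N ^ 2"
  have C0: "C0 \<ge> 0" by (simp add: C0_def)
  have N0: "N > 0" using \<zeta> by (simp add: primitive_root_of_unity_def)
  have norm: "norm \<zeta> = 1" using primitive_root_norm[OF \<zeta>] .
  \<comment> \<open>\<open>exp C0\<close> accounts for all blocks after the first,
    \<open>2 ^ N\<close> for the fewer than N factors left over, and \<open>+ 1\<close> secures
    positivity.\<close>
  show "C0 * exp C0 * 2 ^ N + 1 > 0" using C0 by (simp add: add_nonneg_pos)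
  fix r :: real and m :: nat
  assume r: "0 \<le> r" "r < 1" and m: "N \<le> m"
  define q where "q = of_real r * \<zeta>"
  have q: "norm q \<le> 1" using r norm by (simp add: q_def norm_mult)
  have shift: "q * (q\<^sup>2) ^ (N * t) = of_real (r ^ (2 * N * t)) * q" for t
  proof -
    have "(q\<^sup>2) ^ (N * t) = q ^ (2 * N * t)" by (simp add: power_mult)
    also have "\<dots> = of_real (r ^ (2 * N * t)) * \<zeta> ^ (2 * N * t)"
      unfolding q_def by (simp only: power_mult_distrib of_real_power)
    also have "\<zeta> ^ (2 * N * t) = 1"
      unfolding primitive_root_power_eq_1_iff[OF \<zeta>] by simp
    finally show ?thesis by simp
  qed
  have block: "norm (qpoch q (q\<^sup>2) (N * Suc s)) \<le> C0 * (1 - r) * exp (C0 * (1 - r) * (\<Sum>t<Suc s. r ^ (2 * N * t)))" for s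
  proof (induction s)
    case 0
    have "norm (qpoch q (q\<^sup>2) N) \<le> C0 * (1 - r)"
      using qpoch_block_approx[OF \<zeta> N r(1) less_imp_le[OF r(2)], of 1] N0 by (simp add: q_def C0_def)
    also have "\<dots> \<le> C0 * (1 - r) * exp (C0 * (1 - r))"
      using C0 r by (intro mult_le_cancel_left1[THEN iffD2]) auto
    finally show ?case by simp
  next
    case (Suc s)
    define y where "y = r ^ (2 * N * Suc s)"
    have y: "0 \<le> y" "y \<le> 1" using r by (auto simp: y_def intro: power_le_one)
    have "norm (qpoch (of_real y * q) (q\<^sup>2) N) \<le> norm (1 - of_real y ^ N :: complex) + C0 * (1 - r) * y"
      using qpoch_block_approx[OF \<zeta> N r(1) less_imp_le[OF r(2)] y]
        norm_triangle_ineq2[of "qpoch (of_real y * q) (q\<^sup>2) N" "1 - of_real y ^ N"]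
      by (simp add: q_def C0_def)
    also have "norm (1 - of_real y ^ N :: complex) = \<bar>1 - y ^ N\<bar>"
      by (metis norm_of_real of_real_1 of_real_diff of_real_power)
    also have "\<dots> \<le> 1" using y by (simp add: power_le_one)
    also have "1 + C0 * (1 - r) * y \<le> exp (C0 * (1 - r) * y)" by (rule exp_ge_add_one_self)
    finally have *: "norm (qpoch (of_real y * q) (q\<^sup>2) N) \<le> exp (C0 * (1 - r) * y)" by simp
    have "norm (qpoch q (q\<^sup>2) (N * Suc (Suc s))) = norm (qpoch q (q\<^sup>2) (N * Suc s)) * norm (qpoch (of_real y * q) (q\<^sup>2) N)"
      using qpoch_add[of q "q\<^sup>2" "N * Suc s" N] unfolding shift y_def
      by (simp only: norm_mult[symmetric] mult_Suc_right[of N "Suc s"] add.commute)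
    also have "\<dots> \<le> (C0 * (1 - r) * exp (C0 * (1 - r) * (\<Sum>t<Suc s. r ^ (2 * N * t)))) * exp (C0 * (1 - r) * y)"
      using C0 r by (intro mult_mono Suc *) auto
    also have "\<dots> = C0 * (1 - r) * exp (C0 * (1 - r) * (\<Sum>t<Suc (Suc s). r ^ (2 * N * t)))"
      by (simp only: mult.assoc exp_add[symmetric] sum.lessThan_Suc[of _ "Suc s"] distrib_left y_def)
    finally show ?case .
  qed
  have geo: "(1 - r) * (\<Sum>t<s. r ^ (2 * N * t)) \<le> 1" for s
  proof -
    have "(\<Sum>t<s. r ^ (2 * N * t)) \<le> (\<Sum>t<s. r ^ t)"
      using r N0 by (intro sum_mono power_decreasing) auto
    then have "(1 - r) * (\<Sum>t<s. r ^ (2 * N * t)) \<le> (1 - r) * (\<Sum>t<s. r ^ t)"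
      using r by (intro mult_left_mono) auto
    also have "\<dots> = 1 - r ^ s" by (rule one_diff_power_eq[symmetric])
    also have "\<dots> \<le> 1" using r by simp
    finally show ?thesis .
  qed
  have block': "norm (qpoch q (q\<^sup>2) (N * Suc s)) \<le> C0 * (1 - r) * exp C0" for s
  proof -
    have "C0 * (1 - r) * (\<Sum>t<Suc s. r ^ (2 * N * t)) \<le> C0 * 1"
      unfolding mult.assoc[of C0 "1 - r"] by (intro mult_left_mono geo C0)
    then have "C0 * (1 - r) * exp (C0 * (1 - r) * (\<Sum>t<Suc s. r ^ (2 * N * t))) \<le> C0 * (1 - r) * exp C0"
      using C0 r by (intro mult_left_mono) auto
    with block[of s] show ?thesis by linarith
  qed
  define s where "s = m div N - 1"
  have m_eq: "m = N * Suc s + m mod N"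
  proof -
    have "m div N \<ge> 1" using m N0 by (simp add: Suc_leI div_greater_zero_iff)
    then have "Suc s = m div N" by (simp add: s_def)
    then show ?thesis by simp
  qed
  have "norm (qpoch q (q\<^sup>2) m) = norm (qpoch q (q\<^sup>2) (N * Suc s)) * norm (qpoch (q * (q\<^sup>2) ^ (N * Suc s)) (q\<^sup>2) (m mod N))"
    by (subst m_eq) (simp only: qpoch_add norm_mult)
  also have "\<dots> \<le> (C0 * (1 - r) * exp C0) * 2 ^ N"
  proof (intro mult_mono block')
    have "norm (q * (q\<^sup>2) ^ (N * Suc s)) \<le> 1"
      unfolding norm_mult norm_power using q by (intro mult_le_one power_le_one) auto
    then have "norm (qpoch (q * (q\<^sup>2) ^ (N * Suc s)) (q\<^sup>2) (m mod N)) \<le> 2 ^ (m mod N)"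
      using q by (intro norm_qpoch_le) (auto simp: norm_power power_le_one)
    also have "\<dots> \<le> 2 ^ N" using N0 by (intro power_increasing) (auto simp: less_imp_le)
    finally show "norm (qpoch (q * (q\<^sup>2) ^ (N * Suc s)) (q\<^sup>2) (m mod N)) \<le> 2 ^ N" .
  qed (use C0 r in auto)
  also have "\<dots> \<le> (C0 * exp C0 * 2 ^ N + 1) * (1 - r)" using r by (simp add: algebra_simps)
  finally show "norm (qpoch (of_real r * \<zeta>) ((of_real r * \<zeta>)\<^sup>2) m) \<le> (C0 * exp C0 * 2 ^ N + 1) * (1 - r)"
    by (simp add: q_def)
qed

text \<open>The first N terms converge individually, and those with k < m < N tend to 0. In the
  tail, the squared products give (1-r)^2 against the factor 1/(1-r) of the geometric series, so the
  tail is O(1-r).\<close>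

lemma terminating_sum_limit:
  assumes \<zeta>: "primitive_root_of_unity (2 * k + 1) \<zeta>"
  shows "((\<lambda>r::real. of_real r * \<zeta> * (\<Sum>m. qpoch (of_real r * \<zeta>) ((of_real r * \<zeta>)\<^sup>2) m ^ 2 * (of_real r * \<zeta>) ^ (2 * m)))
     \<longlongrightarrow> (\<Sum>n=0..k. (\<Prod>i<n. (1 - \<zeta> ^ (2 * i + 1)) ^ 2) * \<zeta> ^ (2 * n + 1))) (at_left 1)"
proof -
  define N where "N = 2 * k + 1"
  have N: "odd N" by (simp add: N_def)
  have \<zeta>N: "primitive_root_of_unity N \<zeta>" using \<zeta> by (simp add: N_def)
  have norm: "norm \<zeta> = 1" using primitive_root_norm[OF \<zeta>] .
  have \<zeta>1: "\<zeta> ^ (2 * k + 1) = 1" using \<zeta> by (simp add: primitive_root_of_unity_def)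
  obtain C where C: "C > 0" "\<And>r m. 0 \<le> r \<Longrightarrow> r < 1 \<Longrightarrow> N \<le> m \<Longrightarrow>
    norm (qpoch (of_real r * \<zeta>) ((of_real r * \<zeta>)\<^sup>2) m) \<le> C * (1 - r)"
    using qpoch_root_of_unity_bound[OF \<zeta>N N] by blast
  define v where "v = (\<lambda>r m. qpoch (of_real r * \<zeta>) ((of_real r * \<zeta>)\<^sup>2) m ^ 2 * (of_real r * \<zeta>) ^ (2 * m))"
  have "((\<lambda>r. \<Sum>m<N. v r m) \<longlongrightarrow> (\<Sum>m<N. (\<Prod>i<m. 1 - of_real 1 * \<zeta> * ((of_real 1 * \<zeta>)\<^sup>2) ^ i) ^ 2 * (of_real 1 * \<zeta>) ^ (2 * m))) (at_left 1)"
    unfolding v_def qpoch_def by (intro tendsto_intros)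
  also have "(\<Sum>m<N. (\<Prod>i<m. 1 - of_real 1 * \<zeta> * ((of_real 1 * \<zeta>)\<^sup>2) ^ i) ^ 2 * (of_real 1 * \<zeta>) ^ (2 * m)) =
      (\<Sum>m<N. (\<Prod>i<m. (1 - \<zeta> ^ (2 * i + 1)) ^ 2) * \<zeta> ^ (2 * m))"
    by (simp add: power_mult prod_power_distrib)
  also have "\<dots> = (\<Sum>m=0..k. (\<Prod>i<m. (1 - \<zeta> ^ (2 * i + 1)) ^ 2) * \<zeta> ^ (2 * m))"
  proof (rule sum.mono_neutral_right)
    show "\<forall>m\<in>{..<N} - {0..k}. (\<Prod>i<m. (1 - \<zeta> ^ (2 * i + 1)) ^ 2) * \<zeta> ^ (2 * m) = 0"
    proof
      fix m assume "m \<in> {..<N} - {0..k}"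
      then have "k \<in> {..<m}" by auto
      moreover have "(1 - \<zeta> ^ (2 * k + 1)) ^ 2 = 0" unfolding \<zeta>1 by simp
      ultimately have "(\<Prod>i<m. (1 - \<zeta> ^ (2 * i + 1)) ^ 2) = 0" by (intro prod_zero) blast+
      then show "(\<Prod>i<m. (1 - \<zeta> ^ (2 * i + 1)) ^ 2) * \<zeta> ^ (2 * m) = 0" by simp
    qed
  qed (auto simp: N_def)
  finally have head: "((\<lambda>r. \<Sum>m<N. v r m) \<longlongrightarrow> (\<Sum>m=0..k. (\<Prod>i<m. (1 - \<zeta> ^ (2 * i + 1)) ^ 2) * \<zeta> ^ (2 * m))) (at_left 1)" .
  have bound: "summable (v r) \<and> norm (\<Sum>m. v r (m + N)) \<le> C\<^sup>2 * (1 - r)" if r: "0 < r" "r < 1" for r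
  proof -
    interpret nome "of_real r * \<zeta>"
      by unfold_locales (use r norm in \<open>auto simp: norm_mult\<close>)
    have s: "summable (v r)" unfolding v_def by (rule bilateral_at_q(1))
    have le: "norm (v r (m + N)) \<le> (C * (1 - r)) ^ 2 * r ^ m" for m
    proof -
      have "r ^ (2 * (m + N)) \<le> r ^ m" using r by (intro power_decreasing) auto
      then have "norm (qpoch (of_real r * \<zeta>) ((of_real r * \<zeta>)\<^sup>2) (m + N)) ^ 2 * r ^ (2 * (m + N)) \<le> (C * (1 - r)) ^ 2 * r ^ m"
        using r by (intro mult_mono power_mono C(2)) auto
      then show ?thesis using r norm by (simp add: v_def norm_mult norm_power)
    qed
    have geo: "(\<lambda>m. (C * (1 - r)) ^ 2 * r ^ m) sums ((C * (1 - r)) ^ 2 * (1 / (1 - r)))"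
      using r by (intro sums_mult geometric_sums) auto
    have "norm (\<Sum>m. v r (m + N)) \<le> (\<Sum>m. (C * (1 - r)) ^ 2 * r ^ m)"
      by (rule norm_suminf_le[OF le sums_summable[OF geo]])
    also have "\<dots> = C\<^sup>2 * (1 - r)"
      using sums_unique[OF geo] r by (simp add: power2_eq_square)
    finally show ?thesis using s by simp
  qed
  have tail: "((\<lambda>r. \<Sum>m. v r (m + N)) \<longlongrightarrow> 0) (at_left 1)"
  proof (rule tendsto_norm_zero_cancel, rule tendsto_sandwich[OF _ _ tendsto_const])
    have "((\<lambda>r::real. C\<^sup>2 * (1 - r)) \<longlongrightarrow> C\<^sup>2 * (1 - 1)) (at_left 1)" by (intro tendsto_intros)
    then show "((\<lambda>r::real. C\<^sup>2 * (1 - r)) \<longlongrightarrow> 0) (at_left 1)" by simp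
    show "eventually (\<lambda>r. norm (\<Sum>m. v r (m + N)) \<le> C\<^sup>2 * (1 - r)) (at_left 1)"
      using eventually_at_left_1 by eventually_elim (use bound in auto)
  qed auto
  have "((\<lambda>r. of_real r * \<zeta> * ((\<Sum>m. v r (m + N)) + (\<Sum>m<N. v r m))) \<longlongrightarrow>
     of_real 1 * \<zeta> * (0 + (\<Sum>m=0..k. (\<Prod>i<m. (1 - \<zeta> ^ (2 * i + 1)) ^ 2) * \<zeta> ^ (2 * m)))) (at_left 1)"
    by (intro tendsto_intros head tail)
  also have "of_real 1 * \<zeta> * (0 + (\<Sum>m=0..k. (\<Prod>i<m. (1 - \<zeta> ^ (2 * i + 1)) ^ 2) * \<zeta> ^ (2 * m))) =
      (\<Sum>n=0..k. (\<Prod>i<n. (1 - \<zeta> ^ (2 * i + 1)) ^ 2) * \<zeta> ^ (2 * n + 1))"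
    by (simp add: sum_distrib_left mult_ac)
  finally show ?thesis
  proof (rule Lim_transform_eventually)
    show "eventually (\<lambda>r. of_real r * \<zeta> * ((\<Sum>m. v r (m + N)) + (\<Sum>m<N. v r m)) =
       of_real r * \<zeta> * (\<Sum>m. qpoch (of_real r * \<zeta>) ((of_real r * \<zeta>)\<^sup>2) m ^ 2 * (of_real r * \<zeta>) ^ (2 * m))) (at_left 1)"
      using eventually_at_left_1
    proof eventually_elim
      case (elim r)
      then have "suminf (v r) = (\<Sum>m. v r (m + N)) + (\<Sum>m<N. v r m)"
        using bound by (intro suminf_split_initial_segment) auto
      then show ?case unfolding v_def by simp
    qed
  qed
qed

lemma correction_limit:
  assumes \<zeta>: "primitive_root_of_unity N \<zeta>" and N: "odd N"
  shows "((\<lambda>r::real. (qpoch_inf (of_real r * \<zeta>) ((of_real r * \<zeta>)\<^sup>2))\<^sup>2 / jtheta (- 1) ((of_real r * \<zeta>) ^ 4) *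
     ((qpoch_inf ((of_real r * \<zeta>)\<^sup>2) ((of_real r * \<zeta>)\<^sup>2))\<^sup>2 * nome.U (of_real r * \<zeta>) 1)) \<longlongrightarrow> 0) (at_left 1)"
    (is "((\<lambda>r. ?A r * ?B r) \<longlongrightarrow> 0) _")
proof -
  obtain c where c: "c > 0" and ev: "eventually (\<lambda>r. norm (?A r) \<le> exp (- c / (1 - r))) (at_left 1)"
    using theta_factor_exponential_decay[OF \<zeta> N] by blast
  have norm: "norm \<zeta> = 1" using primitive_root_norm[OF \<zeta>] .
  have "((\<lambda>r. 2 * (exp (- c / (1 - r)) / (1 - r)\<^sup>2)) \<longlongrightarrow> 2 * 0) (at_left 1)"
    by (intro tendsto_intros exp_inverse_decay c)
  then have lim: "((\<lambda>r. 2 * (exp (- c / (1 - r)) / (1 - r)\<^sup>2)) \<longlongrightarrow> 0) (at_left 1)" by simp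
  show ?thesis
  proof (rule tendsto_norm_zero_cancel, rule tendsto_sandwich[OF _ _ tendsto_const lim])
    show "eventually (\<lambda>r. norm (?A r * ?B r) \<le> 2 * (exp (- c / (1 - r)) / (1 - r)\<^sup>2)) (at_left 1)"
      using ev eventually_at_left_1
    proof eventually_elim
      case (elim r)
      interpret nome "of_real r * \<zeta>"
        by unfold_locales (use elim norm in \<open>auto simp: norm_mult\<close>)
      have "norm (complex_of_real r * \<zeta>) = r" using elim norm by (simp add: norm_mult)
      then have "norm (?B r) \<le> 2 / ((1 - r) * (1 - r\<^sup>2))"
        using norm_U_1_le by simp
      also have "\<dots> \<le> 2 / ((1 - r) * (1 - r))"
      proof -
        \<comment> \<open>Replacing 1 - r^2 by the smaller 1-r matches the quadratic denominator of
          \<open>exp_inverse_decay\<close>.\<close>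
        have "r\<^sup>2 \<le> r" using elim by (simp add: power2_eq_square mult_left_le_one_le)
        then show ?thesis using elim by (intro divide_left_mono mult_left_mono mult_pos_pos) (auto simp: abs_square_less_1)
      qed
      finally have "norm (?A r) * norm (?B r) \<le> exp (- c / (1 - r)) * (2 / ((1 - r) * (1 - r)))"
        using elim by (intro mult_mono) auto
      also have "\<dots> = 2 * (exp (- c / (1 - r)) / (1 - r)\<^sup>2)" by (simp add: power2_eq_square)
      finally show ?case by (simp only: norm_mult[of "?A r" "?B r"])
    qed
  qed auto
qed

theorem theorem0p2:
  fixes k :: nat and \<zeta> :: complex
  assumes "primitive_root_of_unity (2 * k + 1) \<zeta>"
  shows "((\<lambda>r::real. (of_real r * \<zeta>) * mock_w (of_real r * \<zeta>) - theta_w (of_real r * \<zeta>))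
           \<longlongrightarrow> - (\<Sum>n=0..k. (\<Prod>i<n. (1 - \<zeta> ^ (2 * i + 1)) ^ 2) * \<zeta> ^ (2 * n + 1))) (at_left 1)"
proof -
  have norm: "norm \<zeta> = 1" using primitive_root_norm[OF assms] .
  have "odd (2 * k + 1)" by simp
  from tendsto_diff[OF tendsto_minus[OF terminating_sum_limit[OF assms]] correction_limit[OF assms this]]
  show ?thesis
    unfolding diff_0_right
  proof (rule Lim_transform_eventually)
    show "eventually (\<lambda>r. - (of_real r * \<zeta> * (\<Sum>m. qpoch (of_real r * \<zeta>) ((of_real r * \<zeta>)\<^sup>2) m ^ 2 * (of_real r * \<zeta>) ^ (2 * m))) -
       (qpoch_inf (of_real r * \<zeta>) ((of_real r * \<zeta>)\<^sup>2))\<^sup>2 / jtheta (- 1) ((of_real r * \<zeta>) ^ 4) *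
     ((qpoch_inf ((of_real r * \<zeta>)\<^sup>2) ((of_real r * \<zeta>)\<^sup>2))\<^sup>2 * nome.U (of_real r * \<zeta>) 1) =
       (of_real r * \<zeta>) * mock_w (of_real r * \<zeta>) - theta_w (of_real r * \<zeta>)) (at_left 1)"
      using eventually_at_left_1
    proof eventually_elim
      case (elim r)
      interpret nome "of_real r * \<zeta>"
        by unfold_locales (use elim norm in \<open>auto simp: norm_mult\<close>)
      show ?case unfolding mock_w_minus_theta_w by simp
    qed
  qed
qed

end
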